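(* Let the stationary environment $(\Omega,\mathcal F,\mathbb P,\theta)$ and the random transition probabilities $R_\omega$ be as in the context. Assume that $\lim_{n\to\infty}\psi_U(n)=0$ and that the random Doeblin condition (D) described in the context holds. Then there exists a unique (up to $\mathbb P$-null sets) random family of probability measures $\mu_\omega$ on $\mathcal X_\omega$ such that $(R_\omega)^*\mu_\omega=\mu_{\theta\omega}$ for $\mathbb P$-a.a. $\omega$. Moreover, there exists $\rho\in(0,1)$ such that for every finite $p\ge 1$ there is a random variable $K_p\in L^p(\Omega,\mathcal F,\mathbb P)$ such that, $\mathbb P$-a.s., for all $n\in\mathbb N$, $$\max\left(\|R_{\theta^{-n}\omega,n}-\mu_\omega\|_\infty,\ \|R_{\omega,n}-\mu_{\theta^n\omega}\|_\infty\right)\le K_p(\omega)\rho^{n/p}.$$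
   Context: Here $\mathbb N=\{1,2,\dots\}$. Environment. $Y=(Y_j)_{j\in\mathbb Z}$ is a stationary ergodic sequence of random variables with values in a measurable space $\mathcal Y$. $(\Omega,\mathcal F,\mathbb P,\theta)$ is the associated shift system: $\Omega=\mathcal Y^{\mathbb Z}$, $\theta$ is the left shift, $\mathbb P$ is the law of $(Y_j)_{j\in\mathbb Z}$; we write $\omega=(\omega_n)_{n\in\mathbb Z}$ and regard $Y_n$ as the coordinate map $\omega\mapsto\omega_n$. For $-\infty\le k\le\ell\le\infty$, $\mathcal F_{k,\ell}=\sigma\{Y_s: k\le s\le \ell,\ s\in\mathbb Z\}$. The upper $\psi$-mixing coefficients are $$\psi_U(n)=\sup_k\sup\left\{\frac{\mathbb P(A\cap B)}{\mathbb P(A)\mathbb P(B)}-1: A\in\mathcal F_{-\infty,k},\ B\in\mathcal F_{k+n,\infty},\ \mathbb P(A)\mathbb P(B)>0\right\}.$$ Random Markov operators. $\mathcal X$ is a measurable space and $\mathcal X_\omega\subseteq\mathcal X$ are subsets, measurable in $\omega$ and depending only on $\omega_0$. $R_\omega(x,\Gamma)$ ($x\in\mathcal X_\omega$, $\Gamma\subseteq\mathcal X_{\theta\omega}$ measurable) are transition probabilities, measurable in $\omega$ and depending on $\omega$ only through $\omega_0$. We also view $R_\omega$ as the operator $R_\omega g(x)=\int g(y)R_\omega(x,dy)$ on bounded measurable $g:\mathcal X_{\theta\omega}\to\mathbb R$, and set $R_{\omega,n}=R_\omega\circ R_{\theta\omega}\circ\cdots\circ R_{\theta^{n-1}\omega}$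 (with $R_{\omega,n}(x,\Gamma)$ the corresponding $n$-step transition probability from $\mathcal X_\omega$ to $\mathcal X_{\theta^n\omega}$). For a probability measure $\mu$ on $\mathcal X_\omega$, $(R_\omega)^*\mu$ is the measure $\Gamma\mapsto\int R_\omega(x,\Gamma)\,d\mu(x)$ on $\mathcal X_{\theta\omega}$. A random family of measures is one measurable in $\omega$. Norm. With $\|g\|_\infty=\sup|g|$, and for a probability measure $\mu$ on $\mathcal X_{\theta^n\omega}$ viewed as the operator $g\mapsto\mu(g)\mathbf 1$, $\|R_{\omega,n}-\mu\|_\infty=\sup_{\|g\|_\infty\le1}\|R_{\omega,n}g-\mu(g)\|_\infty$, the supremum being over bounded measurable $g$ on $\mathcal X_{\theta^n\omega}$. Random Doeblin condition (D). There are random variables $n_\omega\in\mathbb N$ and $\gamma_\omega\in(0,1)$ and probability measures $m_\omega$ on $\mathcal X_\omega$, measurable in $\omega$ and depending only on $\omega_0$, such that $\mathbb P$-a.s., for all $x\in\mathcal X_{\theta^{-n_\omega}\omega}$ and all measurable $\Gamma\subseteq\mathcal X_\omega$, $$R_{\theta^{-n_\omega}\omega,n_\omega}(x,\Gamma)\ge\gamma_\omega m_\omega(\Gamma).$$ Standing convention: $\gamma_\omega$ depends only on $\omega_0,\omega_{-1},\dots,\omega_{-n_\omega}$ and $n_\omega$ is the minimal positive integer for which this inequality holds, so that for every $M\ge1$ and $\delta>0$ the sets $\{n_\omega\le M\}$ and $\{\gamma_\omega\ge\delta,\ n_\omega\le M\}$ belong to $\mathcal F_{-M,0}$. *)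

theory Defs
  imports "HOL-Probability.Probability"
begin

section \<open>The environment\<close>

abbreviation path_space :: "'y measure \<Rightarrow> (int \<Rightarrow> 'y) measure" where
  "path_space MY \<equiv> PiM (UNIV :: int set) (\<lambda>_. MY)"

text \<open>\<open>lshift k\<close> is the \<open>k\<close>-th (possibly negative) iterate of the left shift \<open>lshift 1\<close>.\<close>

definition lshift :: "int \<Rightarrow> (int \<Rightarrow> 'y) \<Rightarrow> int \<Rightarrow> 'y" where
  "lshift k \<omega> = (\<lambda>j. \<omega> (j + k))"

definition path_law :: "'a measure \<Rightarrow> 'y measure \<Rightarrow> (int \<Rightarrow> 'a \<Rightarrow> 'y) \<Rightarrow> (int \<Rightarrow> 'y) measure" where
  "path_law N MY Y = distr N (path_space MY) (\<lambda>x j. Y j x)"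

definition stationary_process :: "'a measure \<Rightarrow> 'y measure \<Rightarrow> (int \<Rightarrow> 'a \<Rightarrow> 'y) \<Rightarrow> bool" where
  "stationary_process N MY Y \<longleftrightarrow>
     (\<forall>j. Y j \<in> N \<rightarrow>\<^sub>M MY) \<and>
     (\<forall>k. path_law N MY (\<lambda>j. Y (j + k)) = path_law N MY Y)"

definition ergodic_process :: "'a measure \<Rightarrow> 'y measure \<Rightarrow> (int \<Rightarrow> 'a \<Rightarrow> 'y) \<Rightarrow> bool" where
  "ergodic_process N MY Y \<longleftrightarrow>
     (\<forall>A\<in>sets (path_space MY). lshift 1 -` A \<inter> space (path_space MY) = A \<longrightarrow>
        measure (path_law N MY Y) A = 0 \<or> measure (path_law N MY Y) A = 1)"

text \<open>\<open>coord_sigma MY {k..l}\<close> is \<open>\<F>\<^bsub>k,l\<^esub>\<close>; infinite \<open>k\<close>, \<open>l\<close> correspond to \<open>{..l}\<close>, \<open>{k..}\<close>.\<close>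

definition coord_sigma :: "'y measure \<Rightarrow> int set \<Rightarrow> (int \<Rightarrow> 'y) set set" where
  "coord_sigma MY I = sigma_sets (space (path_space MY))
     {(\<lambda>\<omega>. \<omega> s) -` A \<inter> space (path_space MY) | s A. s \<in> I \<and> A \<in> sets MY}"

definition psi_U :: "'y measure \<Rightarrow> (int \<Rightarrow> 'y) measure \<Rightarrow> nat \<Rightarrow> ereal" where
  "psi_U MY P n = (SUP k. SUP (A, B) \<in> {(A, B). A \<in> coord_sigma MY {..k} \<and>
       B \<in> coord_sigma MY {k + int n..} \<and> measure P A * measure P B > 0}.
     ereal (measure P (A \<inter> B) / (measure P A * measure P B) - 1))"

definition depends_on :: "'y measure \<Rightarrow> int set \<Rightarrow> ((int \<Rightarrow> 'y) \<Rightarrow> 'b) \<Rightarrow> bool" where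
  "depends_on MY I f \<longleftrightarrow>
     (\<forall>\<omega>\<in>space (path_space MY). \<forall>\<omega>'\<in>space (path_space MY).
        (\<forall>i\<in>I. \<omega> i = \<omega>' i) \<longrightarrow> f \<omega> = f \<omega>')"

section \<open>Random spaces, measures and Markov operators\<close>

text \<open>Measurability of a random subset \<open>X \<omega>\<close> of the state space means measurability of its graph.\<close>

definition random_subspaces :: "'y measure \<Rightarrow> 'x measure \<Rightarrow> ((int \<Rightarrow> 'y) \<Rightarrow> 'x set) \<Rightarrow> bool" where
  "random_subspaces MY MX X \<longleftrightarrow>
     Sigma (space (path_space MY)) X \<in> sets (path_space MY \<Otimes>\<^sub>M MX) \<and> depends_on MY {0} X"

text \<open>Measures on \<open>X \<omega>\<close> are represented as measures on \<open>MX\<close> giving full mass to \<open>X \<omega>\<close>.\<close>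

definition random_prob_family ::
  "'y measure \<Rightarrow> 'x measure \<Rightarrow> ((int \<Rightarrow> 'y) \<Rightarrow> 'x set) \<Rightarrow> ((int \<Rightarrow> 'y) \<Rightarrow> 'x measure) \<Rightarrow> bool" where
  "random_prob_family MY MX X \<mu> \<longleftrightarrow>
     \<mu> \<in> path_space MY \<rightarrow>\<^sub>M prob_algebra MX \<and>
     (\<forall>\<omega>\<in>space (path_space MY). measure (\<mu> \<omega>) (X \<omega>) = 1)"

text \<open>
  \<open>R \<omega> x\<close> for \<open>x \<in> X \<omega>\<close> is again a measure on all of \<open>MX\<close>. As such it depends on \<open>\<omega>\<close> through
  \<open>\<omega> 0\<close> only, whereas its carrier \<open>X (lshift 1 \<omega>)\<close> depends on \<open>\<omega> 1\<close>; requiring full mass on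
  the carrier for every \<open>\<omega>\<close> would force \<open>R \<omega> x\<close> to live on \<open>X \<omega>'\<close> for every single \<open>\<omega>'\<close>, so
  this is required only for almost every \<open>\<omega>\<close>. Values \<open>R \<omega> x\<close> with \<open>x \<notin> X \<omega>\<close> are irrelevant.
\<close>

definition random_kernel ::
  "'y measure \<Rightarrow> (int \<Rightarrow> 'y) measure \<Rightarrow> 'x measure \<Rightarrow> ((int \<Rightarrow> 'y) \<Rightarrow> 'x set) \<Rightarrow>
   ((int \<Rightarrow> 'y) \<Rightarrow> 'x \<Rightarrow> 'x measure) \<Rightarrow> bool" where
  "random_kernel MY P MX X R \<longleftrightarrow>
     (\<lambda>(\<omega>, x). R \<omega> x) \<in>
       restrict_space (path_space MY \<Otimes>\<^sub>M MX) (Sigma (space (path_space MY)) X) \<rightarrow>\<^sub>M prob_algebra MX \<and>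
     (AE \<omega> in P. \<forall>x\<in>X \<omega>. measure (R \<omega> x) (X (lshift 1 \<omega>)) = 1) \<and>
     depends_on MY {0} (\<lambda>\<omega>. restrict (R \<omega>) (X \<omega>))"

text \<open>
  The operator acts on functions on \<open>X (lshift 1 \<omega>)\<close>: values of \<open>g\<close> elsewhere are ignored, and
  only values of the result on \<open>X \<omega>\<close> are meaningful.
\<close>

definition markov_op ::
  "((int \<Rightarrow> 'y) \<Rightarrow> 'x set) \<Rightarrow> ((int \<Rightarrow> 'y) \<Rightarrow> 'x \<Rightarrow> 'x measure) \<Rightarrow>
   (int \<Rightarrow> 'y) \<Rightarrow> ('x \<Rightarrow> real) \<Rightarrow> 'x \<Rightarrow> real" where
  "markov_op X R \<omega> g x = (LINT y:X (lshift 1 \<omega>)|R \<omega> x. g y)"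

primrec markov_op_iter ::
  "((int \<Rightarrow> 'y) \<Rightarrow> 'x set) \<Rightarrow> ((int \<Rightarrow> 'y) \<Rightarrow> 'x \<Rightarrow> 'x measure) \<Rightarrow>
   nat \<Rightarrow> (int \<Rightarrow> 'y) \<Rightarrow> ('x \<Rightarrow> real) \<Rightarrow> 'x \<Rightarrow> real" where
  "markov_op_iter X R 0 \<omega> g = g"
| "markov_op_iter X R (Suc n) \<omega> g = markov_op X R \<omega> (markov_op_iter X R n (lshift 1 \<omega>) g)"

definition nstep_prob ::
  "((int \<Rightarrow> 'y) \<Rightarrow> 'x set) \<Rightarrow> ((int \<Rightarrow> 'y) \<Rightarrow> 'x \<Rightarrow> 'x measure) \<Rightarrow>
   nat \<Rightarrow> (int \<Rightarrow> 'y) \<Rightarrow> 'x \<Rightarrow> 'x set \<Rightarrow> real" where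
  "nstep_prob X R n \<omega> x \<Gamma> = markov_op_iter X R n \<omega> (indicator \<Gamma>) x"

text \<open>The dual action \<open>\<Gamma> \<mapsto> \<integral> R \<omega> x \<Gamma> d\<mu>(x)\<close>; the kernel is only measurable on \<open>X \<omega>\<close>, hence the
  restriction of \<open>\<mu>\<close>.\<close>

definition dual_markov ::
  "((int \<Rightarrow> 'y) \<Rightarrow> 'x set) \<Rightarrow> ((int \<Rightarrow> 'y) \<Rightarrow> 'x \<Rightarrow> 'x measure) \<Rightarrow>
   (int \<Rightarrow> 'y) \<Rightarrow> 'x measure \<Rightarrow> 'x measure" where
  "dual_markov X R \<omega> \<mu> = restrict_space \<mu> (X \<omega>) \<bind> R \<omega>"

text \<open>The operator norm of \<open>R\<^bsub>\<omega>,n\<^esub> - \<mu>\<close>, for \<open>\<mu>\<close> on \<open>X (lshift n \<omega>)\<close>, taken in \<^typ>\<open>ereal\<close> so that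
  the suprema always make sense.\<close>

definition op_dist ::
  "'x measure \<Rightarrow> ((int \<Rightarrow> 'y) \<Rightarrow> 'x set) \<Rightarrow> ((int \<Rightarrow> 'y) \<Rightarrow> 'x \<Rightarrow> 'x measure) \<Rightarrow>
   nat \<Rightarrow> (int \<Rightarrow> 'y) \<Rightarrow> 'x measure \<Rightarrow> ereal" where
  "op_dist MX X R n \<omega> \<mu> =
     (SUP g \<in> {g \<in> borel_measurable (restrict_space MX (X (lshift (int n) \<omega>))).
               \<forall>y\<in>X (lshift (int n) \<omega>). \<bar>g y\<bar> \<le> 1}.
      SUP x \<in> X \<omega>. ereal \<bar>markov_op_iter X R n \<omega> g x - (LINT y:X (lshift (int n) \<omega>)|\<mu>. g y)\<bar>)"

section \<open>The random Doeblin condition\<close>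

definition doeblin_bound ::
  "'x measure \<Rightarrow> ((int \<Rightarrow> 'y) \<Rightarrow> 'x set) \<Rightarrow> ((int \<Rightarrow> 'y) \<Rightarrow> 'x \<Rightarrow> 'x measure) \<Rightarrow>
   (int \<Rightarrow> 'y) \<Rightarrow> nat \<Rightarrow> real \<Rightarrow> 'x measure \<Rightarrow> bool" where
  "doeblin_bound MX X R \<omega> n \<gamma> m \<longleftrightarrow>
     (\<forall>x\<in>X (lshift (- int n) \<omega>). \<forall>\<Gamma>\<in>sets (restrict_space MX (X \<omega>)).
        nstep_prob X R n (lshift (- int n) \<omega>) x \<Gamma> \<ge> \<gamma> * measure m \<Gamma>)"

text \<open>
  The last four conjuncts are the standing convention on \<open>n\<close> and \<open>\<gamma>\<close>: minimality of \<open>n \<omega>\<close> (for the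
  given \<open>\<gamma> \<omega>\<close>), locality of \<open>\<gamma>\<close>, and the resulting measurability with respect to
  \<open>\<F>\<^bsub>-M,0\<^esub>\<close>. The latter is listed explicitly because the bound, and with it minimality, holds only
  almost surely.
\<close>

definition random_doeblin ::
  "'y measure \<Rightarrow> (int \<Rightarrow> 'y) measure \<Rightarrow> 'x measure \<Rightarrow> ((int \<Rightarrow> 'y) \<Rightarrow> 'x set) \<Rightarrow>
   ((int \<Rightarrow> 'y) \<Rightarrow> 'x \<Rightarrow> 'x measure) \<Rightarrow> bool" where
  "random_doeblin MY P MX X R \<longleftrightarrow>
     (\<exists>(n :: (int \<Rightarrow> 'y) \<Rightarrow> nat) (\<gamma> :: (int \<Rightarrow> 'y) \<Rightarrow> real) (m :: (int \<Rightarrow> 'y) \<Rightarrow> 'x measure).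
        n \<in> path_space MY \<rightarrow>\<^sub>M count_space UNIV \<and>
        (\<forall>\<omega>\<in>space (path_space MY). 1 \<le> n \<omega>) \<and>
        \<gamma> \<in> borel_measurable (path_space MY) \<and>
        (\<forall>\<omega>\<in>space (path_space MY). 0 < \<gamma> \<omega> \<and> \<gamma> \<omega> < 1) \<and>
        random_prob_family MY MX X m \<and> depends_on MY {0} m \<and>
        (AE \<omega> in P. doeblin_bound MX X R \<omega> (n \<omega>) (\<gamma> \<omega>) (m \<omega>)) \<and>
        (AE \<omega> in P. \<forall>k. 1 \<le> k \<and> k < n \<omega> \<longrightarrow> \<not> doeblin_bound MX X R \<omega> k (\<gamma> \<omega>) (m \<omega>)) \<and>
        (\<forall>\<omega>\<in>space (path_space MY). \<forall>\<omega>'\<in>space (path_space MY).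
           (\<forall>i\<in>{- int (n \<omega>)..0}. \<omega> i = \<omega>' i) \<longrightarrow> \<gamma> \<omega> = \<gamma> \<omega>') \<and>
        (\<forall>M\<ge>1. {\<omega>\<in>space (path_space MY). n \<omega> \<le> M} \<in> coord_sigma MY {- int M..0}) \<and>
        (\<forall>M\<ge>1. \<forall>\<delta>>0. {\<omega>\<in>space (path_space MY). \<gamma> \<omega> \<ge> \<delta> \<and> n \<omega> \<le> M}
           \<in> coord_sigma MY {- int M..0}))"

end

(*
  Along an orbit of good environments, a Doeblin block ending at a time t contracts oscillations by
  1 - gamma. Let A be the event {gamma >= d, n <= M}, with d and M chosen such that P(A) >= 3/4, and
  look at A only at the multiples of L = M + n0, where psi_U(n0) < 1. The blocks ending there lie in
  disjoint windows separated by gaps of length n0, so mixing gives P(no A at the times in J) <=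
  (2 P(A^c))^|J| <= 2^(-|J|). Expanding the product of the factors 1 - d 1_A = (1 - d) + d 1_{A^c} over
  subsets J then bounds the expected contraction after n steps by (1 - d/2)^(n div L). Since the
  contraction v_n lies in [0,1], one random variable S = sum_n rho^(-n) v_n in L^1 serves all p at
  once: v_n <= v_n^(1/p) <= rho^(n/p) S^(1/p).

  The measure mu is the total variation limit of the pullbacks of the measures m of the Doeblin
  condition; its invariance and uniqueness follow from the same contraction estimate.
*)
theory Submission
  imports Defs
begin

section \<open>Oscillation of integrals and total variation\<close>

text \<open>\<open>psi_U\<close> controls intersections from above only. The product of the factors
  \<open>1 - d * indicator A\<close> must therefore be written with nonnegative coefficients before
  mixing can be applied, and this is why the complement of A appears. Each further window costs a
  factor \<open>1 + psi_U < 2\<close>, so the bound is useful as soon as the complement has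
  probability below 1/2; the level 3/4 turns that factor into 1/2. The state space has no topology,
  so limits of measures are taken set by set. It is the uniformity of the contraction over all sets
  that makes such a limit countably additive and lets it pass through a kernel. The support property
  and the Doeblin bound hold only almost surely, while a contraction estimate reads them along a
  whole orbit. They are collected on one measurable shift-invariant set of full measure, where the
  argument is pointwise. The forward and the pullback bounds then become one estimate with two
  starting points.\<close>

lemma integral_bind_bounded:
  fixes f :: "'b \<Rightarrow> real"
  assumes \<alpha>: "\<alpha> \<in> space (prob_algebra M)" and K: "K \<in> M \<rightarrow>\<^sub>M prob_algebra N"
    and f: "f \<in> borel_measurable N" and B: "\<And>x. x \<in> space N \<Longrightarrow> \<bar>f x\<bar> \<le> B"
  shows "(LINT x|(\<alpha> \<bind> K). f x) = (LINT x|\<alpha>. LINT y|K x. f y)"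
proof -
  have s: "sets \<alpha> = sets M" and p: "prob_space \<alpha>" using \<alpha> by (auto simp: space_prob_algebra)
  have K': "K \<in> \<alpha> \<rightarrow>\<^sub>M subprob_algebra N"
    using measurable_prob_algebraD[OF K] s by (simp cong: measurable_cong_sets)
  show ?thesis
  proof (rule integral_bind[OF f _ K', where B=B and B'=1])
    show "finite_measure \<alpha>" using p by (rule prob_space.finite_measure)
    show "AE x in \<alpha>. emeasure (K x) (space (K x)) \<le> ennreal 1"
      using measurable_space[OF K'] by (intro AE_I2) (auto simp: space_subprob_algebra dest: subprob_space.emeasure_space_le_1)
  qed (use B in auto)
qed

lemma prob_algebra_integrable:
  fixes f :: "'b \<Rightarrow> real"
  assumes "\<alpha> \<in> space (prob_algebra M)" "f \<in> borel_measurable M" "\<And>x. x \<in> space M \<Longrightarrow> \<bar>f x\<bar> \<le> B"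
  shows "integrable \<alpha> f"
proof -
  have s: "sets \<alpha> = sets M" and p: "prob_space \<alpha>" using assms by (auto simp: space_prob_algebra)
  interpret prob_space \<alpha> by fact
  show ?thesis
    using assms sets_eq_imp_space_eq[OF s] measurable_cong_sets[OF s refl]
    by (intro integrable_const_bound[where B=B] AE_I2) auto
qed

lemma kernel_integral_measurable:
  fixes f :: "'b \<Rightarrow> real"
  assumes "K \<in> M \<rightarrow>\<^sub>M prob_algebra N" "f \<in> borel_measurable N"
  shows "(\<lambda>x. LINT y|K x. f y) \<in> borel_measurable M"
  using measurable_compose[OF measurable_prob_algebraD[OF assms(1)] integral_measurable_subprob_algebra[OF assms(2)]] .

lemma prob_algebra_integral_bounded:
  fixes f :: "'b \<Rightarrow> real"
  assumes \<alpha>: "\<alpha> \<in> space (prob_algebra M)" and f: "f \<in> borel_measurable M"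
    and B: "\<And>x. x \<in> space M \<Longrightarrow> \<bar>f x\<bar> \<le> B"
  shows "\<bar>LINT x|\<alpha>. f x\<bar> \<le> B"
proof -
  have s: "sets \<alpha> = sets M" and p: "prob_space \<alpha>" using assms by (auto simp: space_prob_algebra)
  interpret prob_space \<alpha> by fact
  have i: "integrable \<alpha> f" using prob_algebra_integrable[OF \<alpha> f B] .
  have "\<bar>LINT x|\<alpha>. f x\<bar> \<le> (LINT x|\<alpha>. \<bar>f x\<bar>)" by (rule integral_abs_bound)
  also have "\<dots> \<le> (LINT x|\<alpha>. B)"
    using i B sets_eq_imp_space_eq[OF s] by (intro integral_mono) auto
  finally show ?thesis by (simp add: prob_space)
qed

lemma prob_algebra_AE_full:
  assumes "\<alpha> \<in> space (prob_algebra M)" "A \<in> sets M" "measure \<alpha> A = 1"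
  shows "AE x in \<alpha>. x \<in> A"
  using assms prob_space.AE_prob_1[of \<alpha> A] by (auto simp: space_prob_algebra)

text \<open>Integrate the pointwise bound in x against \<alpha>, then in y against \<beta>; the
  bound is available on a carrier A only. Applied to two transition probabilities, this says that a
  Markov step does not increase oscillation; applied to two initial laws, it bounds their distance
  after n steps.\<close>

lemma integral_diff_le_oscillation:
  fixes f :: "'b \<Rightarrow> real"
  assumes \<alpha>: "\<alpha> \<in> space (prob_algebra M)" and \<beta>: "\<beta> \<in> space (prob_algebra M)"
    and A: "A \<in> sets M" "measure \<alpha> A = 1" "measure \<beta> A = 1"
    and f: "f \<in> borel_measurable M" and B: "\<And>x. x \<in> space M \<Longrightarrow> \<bar>f x\<bar> \<le> B"
    and c: "\<And>x y. x \<in> A \<Longrightarrow> y \<in> A \<Longrightarrow> f x - f y \<le> c"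
  shows "(LINT x|\<alpha>. f x) - (LINT x|\<beta>. f x) \<le> c"
proof -
  interpret \<alpha>: prob_space \<alpha> using \<alpha> by (simp add: space_prob_algebra)
  interpret \<beta>: prob_space \<beta> using \<beta> by (simp add: space_prob_algebra)
  have i: "integrable \<alpha> f" "integrable \<beta> f" using prob_algebra_integrable[OF _ f B] \<alpha> \<beta> by auto
  have 1: "(LINT x|\<alpha>. f x) \<le> c + f y" if "y \<in> A" for y
  proof -
    have "(LINT x|\<alpha>. f x) \<le> (LINT x|\<alpha>. c + f y)"
      using i(1) prob_algebra_AE_full[OF \<alpha> A(1,2)] c[OF _ that]
      by (intro integral_mono_AE) (auto simp: algebra_simps elim!: AE_mp)
    then show ?thesis by (simp add: \<alpha>.prob_space)
  qed
  have "(LINT x|\<beta>. (LINT x|\<alpha>. f x) - c) \<le> (LINT y|\<beta>. f y)"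
    using i(2) prob_algebra_AE_full[OF \<beta> A(1,3)] 1
    by (intro integral_mono_AE) (auto simp: algebra_simps elim!: AE_mp)
  then show ?thesis by (simp add: \<beta>.prob_space)
qed

text \<open>The minorization is given for subsets of A only. Since m gives A full mass, intersecting
  with A extends it to all of \<open>sets M\<close>; it is then an inequality between measures and
  can be integrated. Negative values of f off A are invisible to both measures.\<close>

lemma integral_ge_of_minorized:
  fixes f :: "'b \<Rightarrow> real"
  assumes \<kappa>: "\<kappa> \<in> space (prob_algebra M)" and m: "m \<in> space (prob_algebra M)"
    and A: "A \<in> sets M" "measure \<kappa> A = 1" "measure m A = 1"
    and g: "0 \<le> \<gamma>" and le: "\<And>\<Gamma>. \<Gamma> \<in> sets M \<Longrightarrow> \<Gamma> \<subseteq> A \<Longrightarrow> \<gamma> * measure m \<Gamma> \<le> measure \<kappa> \<Gamma>"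
    and f: "f \<in> borel_measurable M" and B: "\<And>x. x \<in> space M \<Longrightarrow> \<bar>f x\<bar> \<le> B"
    and nn: "\<And>x. x \<in> A \<Longrightarrow> 0 \<le> f x"
  shows "\<gamma> * (LINT x|m. f x) \<le> (LINT x|\<kappa>. f x)"
proof -
  interpret \<kappa>: prob_space \<kappa> using \<kappa> by (simp add: space_prob_algebra)
  interpret m: prob_space m using m by (simp add: space_prob_algebra)
  have s: "sets \<kappa> = sets M" "sets m = sets M" using \<kappa> m by (auto simp: space_prob_algebra)
  have ae: "AE x in \<kappa>. x \<in> A" "AE x in m. x \<in> A"
    using prob_algebra_AE_full \<kappa> m A by auto
  have i: "integrable \<kappa> f" "integrable m f" using prob_algebra_integrable[OF _ f B] \<kappa> m by auto
  have "scale_measure (ennreal \<gamma>) m \<le> \<kappa>"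
  proof (subst le_measure)
    show "\<forall>\<Gamma>\<in>sets (scale_measure (ennreal \<gamma>) m). emeasure (scale_measure (ennreal \<gamma>) m) \<Gamma> \<le> emeasure \<kappa> \<Gamma>"
    proof
      fix \<Gamma> assume "\<Gamma> \<in> sets (scale_measure (ennreal \<gamma>) m)"
      then have G: "\<Gamma> \<in> sets M" using s by simp
      have "measure m \<Gamma> = measure m (\<Gamma> \<inter> A)"
        using ae(2) G A s by (intro m.finite_measure_eq_AE) (auto elim!: AE_mp)
      then have "\<gamma> * measure m \<Gamma> \<le> measure \<kappa> (\<Gamma> \<inter> A)" using le[of "\<Gamma> \<inter> A"] G A by auto
      also have "\<dots> \<le> measure \<kappa> \<Gamma>" using G s by (intro \<kappa>.finite_measure_mono) auto
      finally show "emeasure (scale_measure (ennreal \<gamma>) m) \<Gamma> \<le> emeasure \<kappa> \<Gamma>"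
        using g by (simp add: m.emeasure_eq_measure \<kappa>.emeasure_eq_measure ennreal_mult[symmetric])
    qed
  qed (use s in simp)
  then have "(\<integral>\<^sup>+x. ennreal (f x) \<partial>scale_measure (ennreal \<gamma>) m) \<le> (\<integral>\<^sup>+x. ennreal (f x) \<partial>\<kappa>)"
    using s by (intro nn_integral_mono_measure) auto
  moreover have "(\<integral>\<^sup>+x. ennreal (f x) \<partial>scale_measure (ennreal \<gamma>) m) = ennreal \<gamma> * (\<integral>\<^sup>+x. ennreal (f x) \<partial>m)"
    using f s measurable_cong_sets[OF s(2) refl] by (intro nn_integral_scale_measure) auto
  moreover have "(\<integral>\<^sup>+x. ennreal (f x) \<partial>m) = ennreal (LINT x|m. f x)"
    using i ae nn by (intro nn_integral_eq_integral) (auto elim!: AE_mp)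
  moreover have "(\<integral>\<^sup>+x. ennreal (f x) \<partial>\<kappa>) = ennreal (LINT x|\<kappa>. f x)"
    using i ae nn by (intro nn_integral_eq_integral) (auto elim!: AE_mp)
  moreover have "0 \<le> (LINT x|\<kappa>. f x)" using ae nn by (intro integral_nonneg_AE) (auto elim!: AE_mp)
  moreover have "0 \<le> (LINT x|m. f x)" using ae nn by (intro integral_nonneg_AE) (auto elim!: AE_mp)
  ultimately show ?thesis using g by (simp add: ennreal_mult[symmetric])
qed

text \<open>With \<^term>\<open>a = Inf (f ` A)\<close>, minorization is applied to the nonnegative functions \<^term>\<open>f - a\<close> under
  one kernel and \<^term>\<open>a + c - f\<close> under the other; the integrals against \<^term>\<open>m\<close> cancel in the sum.\<close>

lemma minorized_contraction:
  fixes f :: "'b \<Rightarrow> real"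
  assumes \<kappa>: "\<kappa> \<in> space (prob_algebra M)" "\<kappa>' \<in> space (prob_algebra M)" and m: "m \<in> space (prob_algebra M)"
    and A: "A \<in> sets M" "measure \<kappa> A = 1" "measure \<kappa>' A = 1" "measure m A = 1"
    and g: "0 \<le> \<gamma>"
    and le: "\<And>\<Gamma>. \<Gamma> \<in> sets M \<Longrightarrow> \<Gamma> \<subseteq> A \<Longrightarrow> \<gamma> * measure m \<Gamma> \<le> measure \<kappa> \<Gamma>"
    and le': "\<And>\<Gamma>. \<Gamma> \<in> sets M \<Longrightarrow> \<Gamma> \<subseteq> A \<Longrightarrow> \<gamma> * measure m \<Gamma> \<le> measure \<kappa>' \<Gamma>"
    and f: "f \<in> borel_measurable M" and B: "\<And>x. x \<in> space M \<Longrightarrow> \<bar>f x\<bar> \<le> B"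
    and c: "\<And>x y. x \<in> A \<Longrightarrow> y \<in> A \<Longrightarrow> f x - f y \<le> c"
  shows "(LINT x|\<kappa>. f x) - (LINT x|\<kappa>'. f x) \<le> (1 - \<gamma>) * c"
proof -
  define a where "a = (INF x\<in>A. f x)"
  have sub: "A \<subseteq> space M" using A(1) sets.sets_into_space by blast
  have ne: "A \<noteq> {}" using A(4) by auto
  have bdd: "bdd_below (f ` A)" using B sub by (intro bdd_belowI2[where m="-B"]) fastforce
  have lo: "0 \<le> f x - a" if "x \<in> A" for x using cINF_lower[OF bdd that] by (simp add: a_def)
  have hi: "0 \<le> a + c - f x" if "x \<in> A" for x
  proof -
    have "f x - c \<le> a" unfolding a_def using ne c[OF that] by (intro cINF_greatest) (auto simp: algebra_simps)
    then show ?thesis by simp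
  qed
  interpret \<kappa>: prob_space \<kappa> using \<kappa> by (simp add: space_prob_algebra)
  interpret \<kappa>': prob_space \<kappa>' using \<kappa> by (simp add: space_prob_algebra)
  interpret m: prob_space m using m by (simp add: space_prob_algebra)
  have i: "integrable \<kappa> f" "integrable \<kappa>' f" "integrable m f" using prob_algebra_integrable[OF _ f B] \<kappa> m by auto
  have 1: "\<gamma> * (LINT x|m. f x - a) \<le> (LINT x|\<kappa>'. f x - a)"
    by (rule integral_ge_of_minorized[OF \<kappa>(2) m A(1,3,4) g le', where B="B + \<bar>a\<bar>"])
       (use f lo in \<open>auto dest!: B\<close>)
  have 2: "\<gamma> * (LINT x|m. a + c - f x) \<le> (LINT x|\<kappa>. a + c - f x)"
    by (rule integral_ge_of_minorized[OF \<kappa>(1) m A(1,2,4) g le, where B="B + \<bar>a + c\<bar>"])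
       (use f hi in \<open>auto dest!: B\<close>)
  have "\<gamma> * ((LINT x|m. f x) - a) \<le> (LINT x|\<kappa>'. f x) - a"
    using 1 i by (simp add: \<kappa>'.prob_space m.prob_space)
  moreover have "\<gamma> * (a + c - (LINT x|m. f x)) \<le> a + c - (LINT x|\<kappa>. f x)"
    using 2 i by (simp add: \<kappa>.prob_space m.prob_space)
  ultimately show ?thesis by (simp add: algebra_simps)
qed

section \<open>Setwise convergence of probability measures, uniform over sets\<close>

text \<open>A function with values in [0,1] is uniformly close to an average of indicators, and each
  indicator contributes at most e, so the constant is not enlarged. This is the device for passing a
  limit of measures through a kernel, with f the probability of a fixed set.\<close>

lemma integral_diff_le_of_measure_diff_le:
  fixes f :: "'b \<Rightarrow> real"
  assumes \<alpha>: "\<alpha> \<in> space (prob_algebra M)" and \<beta>: "\<beta> \<in> space (prob_algebra M)"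
    and le: "\<And>A. A \<in> sets M \<Longrightarrow> \<bar>measure \<alpha> A - measure \<beta> A\<bar> \<le> e"
    and f: "f \<in> borel_measurable M" and B: "\<And>x. x \<in> space M \<Longrightarrow> 0 \<le> f x \<and> f x \<le> 1"
  shows "\<bar>(LINT x|\<alpha>. f x) - (LINT x|\<beta>. f x)\<bar> \<le> e"
proof -
  have B': "\<bar>f x\<bar> \<le> 1" if "x \<in> space M" for x using B[OF that] by auto
  have bound: "\<bar>(LINT x|\<alpha>. f x) - (LINT x|\<beta>. f x)\<bar> \<le> e + 2 / k" if k: "k > 0" for k :: nat
  proof -
    \<comment> \<open>layer-cake discretization: \<open>s\<close> is \<open>f\<close> rounded down to a multiple of \<open>1 / k\<close>\<close>
    define S where "S i = {x \<in> space M. real i \<le> k * f x}" for i :: nat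
    define s where "s x = (\<Sum>i=1..k. indicator (S i) x / real k)" for x
    have S: "S i \<in> sets M" for i unfolding S_def using f by measurable
    have sm: "s \<in> borel_measurable M" unfolding s_def using S by measurable
    have near: "0 \<le> f x - s x \<and> f x - s x \<le> 1 / k" if x: "x \<in> space M" for x
    proof -
      define j where "j = nat \<lfloor>k * f x\<rfloor>"
      have kf: "0 \<le> k * f x" "k * f x \<le> k" using B[OF x] k by (auto simp: mult_left_le)
      have j: "real j \<le> k * f x" "k * f x < j + 1" using kf by (simp_all add: j_def) linarith
      have jk: "j \<le> k" using kf j by linarith
      have iff: "x \<in> S i \<longleftrightarrow> i \<le> j" for i using x j by (auto simp: S_def)
      have "s x = (\<Sum>i\<in>{1..k}. if i \<le> j then 1 / real k else 0)"
        unfolding s_def by (intro sum.cong) (auto simp: indicator_def iff)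
      also have "\<dots> = (\<Sum>i\<in>{1..j}. 1 / real k)"
        using jk by (intro sum.mono_neutral_cong_right) auto
      finally have "s x = j / k" by simp
      moreover have "j / k \<le> f x" "f x \<le> (j + 1) / k"
        using j k by (simp_all add: pos_divide_le_eq pos_le_divide_eq mult.commute)
      ultimately show ?thesis by (simp add: add_divide_distrib)
    qed
    have int: "\<bar>(LINT x|\<mu>. f x) - (\<Sum>i=1..k. measure \<mu> (S i) / k)\<bar> \<le> 1 / k"
      if \<mu>: "\<mu> \<in> space (prob_algebra M)" for \<mu>
    proof -
      interpret \<mu>: prob_space \<mu> using \<mu> by (simp add: space_prob_algebra)
      have st: "sets \<mu> = sets M" using \<mu> by (simp add: space_prob_algebra)
      have ind: "integrable \<mu> (\<lambda>x. indicator (S i) x / real k :: real)" for i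
        using S st by (intro integrable_divide integrable_real_indicator) (auto simp: \<mu>.emeasure_eq_measure)
      have "(LINT x|\<mu>. s x) = (\<Sum>i=1..k. measure \<mu> (S i) / k)"
        unfolding s_def using ind S st sets.Int_space_eq2[of _ \<mu>] by (subst Bochner_Integration.integral_sum) auto
      moreover have if': "integrable \<mu> f" using prob_algebra_integrable[OF \<mu> f B'] .
      moreover have "integrable \<mu> s" unfolding s_def using ind by auto
      moreover have "\<bar>LINT x|\<mu>. f x - s x\<bar> \<le> 1 / k"
        using near f sm by (intro prob_algebra_integral_bounded[OF \<mu>]) fastforce+
      ultimately show ?thesis by simp
    qed
    have "\<bar>(\<Sum>i=1..k. measure \<alpha> (S i) / k) - (\<Sum>i=1..k. measure \<beta> (S i) / k)\<bar>
        = \<bar>\<Sum>i=1..k. (measure \<alpha> (S i) - measure \<beta> (S i)) / k\<bar>"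
      by (simp add: sum_subtractf diff_divide_distrib)
    also have "\<dots> \<le> (\<Sum>i=1..k. \<bar>(measure \<alpha> (S i) - measure \<beta> (S i)) / k\<bar>)" by (rule sum_abs)
    also have "\<dots> \<le> (\<Sum>i=1..k. e / k)" using le[OF S] k by (intro sum_mono) (auto simp: divide_right_mono)
    also have "\<dots> = e" using k by simp
    finally show ?thesis using int[OF \<alpha>] int[OF \<beta>] by (simp add: abs_le_iff)
  qed
  have "(\<lambda>k. e + 2 / real (Suc k)) \<longlonglongrightarrow> e + 0"
    by (intro tendsto_intros) (use LIMSEQ_Suc[OF lim_const_over_n[of 2]] in simp)
  then show ?thesis
    using LIMSEQ_le_const bound[OF zero_less_Suc] by fastforce
qed

text \<open>The rate \<open>v n\<close> does not depend on the set. For sets decreasing to the empty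
  set one can fix n first and use that the limit is at most \<open>v n\<close> plus the mass under
  \<open>\<nu> n\<close>; this continuity at the empty set yields countable additivity.\<close>

lemma total_variation_limit:
  assumes \<nu>: "\<And>n. \<nu> n \<in> space (prob_algebra M)"
    and cauchy: "\<And>n l A. A \<in> sets M \<Longrightarrow> \<bar>measure (\<nu> (n + l)) A - measure (\<nu> n) A\<bar> \<le> v n"
    and v: "v \<longlonglongrightarrow> 0"
  shows "\<exists>\<mu>\<in>space (prob_algebra M). \<forall>A\<in>sets M. \<forall>n. \<bar>measure \<mu> A - measure (\<nu> n) A\<bar> \<le> v n"
proof -
  have sp: "sets (\<nu> n) = sets M" "prob_space (\<nu> n)" for n using \<nu> by (auto simp: space_prob_algebra)
  interpret \<nu>: prob_space "\<nu> n" for n by (rule sp)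
  have conv: "convergent (\<lambda>n. measure (\<nu> n) A)" if A: "A \<in> sets M" for A
  proof (rule Cauchy_convergent, rule CauchyI')
    fix e :: real assume "0 < e"
    with v have "\<forall>\<^sub>F n in sequentially. v n < e" by (rule order_tendstoD)
    then obtain n0 where n0: "\<And>n. n \<ge> n0 \<Longrightarrow> v n < e" by (auto simp: eventually_sequentially)
    show "\<exists>N0. \<forall>m\<ge>N0. \<forall>n>m. dist (measure (\<nu> m) A) (measure (\<nu> n) A) < e"
    proof (intro exI allI impI)
      fix m n assume "n0 \<le> m" "m < n"
      then have "\<bar>measure (\<nu> (m + (n - m))) A - measure (\<nu> m) A\<bar> \<le> v m" using cauchy[OF A] by blast
      then show "dist (measure (\<nu> m) A) (measure (\<nu> n) A) < e"
        using n0[OF \<open>n0 \<le> m\<close>] \<open>m < n\<close> by (simp add: dist_real_def abs_minus_commute)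
    qed
  qed
  define F where "F A = lim (\<lambda>n. measure (\<nu> n) A)" for A
  have lim: "(\<lambda>n. measure (\<nu> n) A) \<longlonglongrightarrow> F A" if "A \<in> sets M" for A
    using conv[OF that] by (simp add: F_def convergent_LIMSEQ_iff)
  have nn: "0 \<le> F A" if "A \<in> sets M" for A
    using lim[OF that] by (rule LIMSEQ_le_const) auto
  have near: "\<bar>F A - measure (\<nu> n) A\<bar> \<le> v n" if A: "A \<in> sets M" for A n
  proof (rule LIMSEQ_le_const2)
    show "(\<lambda>l. \<bar>measure (\<nu> (l + n)) A - measure (\<nu> n) A\<bar>) \<longlonglongrightarrow> \<bar>F A - measure (\<nu> n) A\<bar>"
      by (intro tendsto_intros LIMSEQ_ignore_initial_segment lim A)
    show "\<exists>N0. \<forall>l\<ge>N0. \<bar>measure (\<nu> (l + n)) A - measure (\<nu> n) A\<bar> \<le> v n"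
      using cauchy[OF A, of n] by (metis add.commute)
  qed
  have add: "F (A \<union> B) = F A + F B" if "A \<in> sets M" "B \<in> sets M" "A \<inter> B = {}" for A B
  proof (rule LIMSEQ_unique[OF lim])
    have "(\<lambda>n. measure (\<nu> n) (A \<union> B)) = (\<lambda>n. measure (\<nu> n) A + measure (\<nu> n) B)"
      using that sp by (auto intro!: ext \<nu>.finite_measure_Union)
    then show "(\<lambda>n. measure (\<nu> n) (A \<union> B)) \<longlonglongrightarrow> F A + F B"
      using tendsto_add[OF lim lim, of A B] that by simp
  qed (use that in auto)
  have ca: "countably_additive (sets M) (\<lambda>A. ennreal (F A))"
  proof (rule sets.empty_continuous_imp_countably_additive)
    show "positive (sets M) (\<lambda>A. ennreal (F A))" by (simp add: positive_def F_def)
    show "additive (sets M) (\<lambda>A. ennreal (F A))" using add nn by (simp add: additive_def)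
    fix A :: "nat \<Rightarrow> _" assume A: "range A \<subseteq> sets M" "decseq A" "(\<Inter>i. A i) = {}"
    have "(\<lambda>i. F (A i)) \<longlonglongrightarrow> 0"
    proof (rule LIMSEQ_I)
      fix e :: real assume e: "0 < e"
      then have "\<forall>\<^sub>F n in sequentially. v n < e/2" using v by (intro order_tendstoD) auto
      then obtain n where n: "v n < e/2" by (auto simp: eventually_sequentially)
      have "(\<lambda>i. measure (\<nu> n) (A i)) \<longlonglongrightarrow> measure (\<nu> n) (\<Inter>i. A i)"
        using A sp by (intro \<nu>.finite_Lim_measure_decseq) auto
      then have "\<forall>\<^sub>F i in sequentially. measure (\<nu> n) (A i) < e/2"
        using e A(3) by (intro order_tendstoD) auto
      then obtain i0 where i0: "\<And>i. i \<ge> i0 \<Longrightarrow> measure (\<nu> n) (A i) < e/2" by (auto simp: eventually_sequentially)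
      show "\<exists>N0. \<forall>i\<ge>N0. norm (F (A i) - 0) < e"
      proof (intro exI allI impI)
        fix i assume "i0 \<le> i"
        have "A i \<in> sets M" using A by auto
        from near[OF this, of n] nn[OF this] i0[OF \<open>i0 \<le> i\<close>] n show "norm (F (A i) - 0) < e" by auto
      qed
    qed
    then show "(\<lambda>i. ennreal (F (A i))) \<longlonglongrightarrow> 0" using tendsto_ennrealI by fastforce
  qed simp
  define \<mu> where "\<mu> = measure_of (space M) (sets M) (\<lambda>A. ennreal (F A))"
  have s: "sets \<mu> = sets M" "space \<mu> = space M" by (auto simp: \<mu>_def)
  have em: "emeasure \<mu> A = ennreal (F A)" if "A \<in> sets M" for A
    using that ca s
    by (intro emeasure_measure_of[OF \<mu>_def]) (simp_all add: sets.space_closed positive_def F_def)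
  have "F (space M) = 1"
  proof (rule LIMSEQ_unique[OF lim])
    have "measure (\<nu> n) (space M) = 1" for n
      using \<nu>.prob_space[of n] sets_eq_imp_space_eq[OF sp(1)] by simp
    then show "(\<lambda>n. measure (\<nu> n) (space M)) \<longlonglongrightarrow> 1" by simp
  qed simp
  then have "prob_space \<mu>" by (intro prob_spaceI) (simp add: em s)
  then have "\<mu> \<in> space (prob_algebra M)" by (simp add: s space_prob_algebra)
  moreover have "measure \<mu> A = F A" if "A \<in> sets M" for A using em[OF that] nn[OF that] by (simp add: measure_def)
  ultimately show ?thesis using near by (intro bexI[of _ \<mu>]) simp_all
qed

section \<open>Kernels along an orbit of the shift\<close>

lemma lshift_lshift [simp]: "lshift j (lshift k \<omega>) = lshift (j + k) \<omega>"
  by (simp add: lshift_def add.assoc)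

lemma lshift_0 [simp]: "lshift 0 \<omega> = \<omega>"
  by (simp add: lshift_def)

lemma lshift_measurable [measurable]: "lshift k \<in> path_space MY \<rightarrow>\<^sub>M path_space MY"
  unfolding lshift_def by (rule measurable_PiM_single') (auto simp: space_PiM)

lemma lshift_space: "\<omega> \<in> space (path_space MY) \<Longrightarrow> lshift k \<omega> \<in> space (path_space MY)"
  by (rule measurable_space[OF lshift_measurable])

text \<open>The measure-valued counterpart of \<open>markov_op_iter\<close>. It is built from a
  kernel on the whole of MX, so that the monad laws for \<open>bind\<close> apply without
  restricting to carriers.\<close>

primrec kernel_iter :: "'x measure \<Rightarrow> ((int \<Rightarrow> 'y) \<Rightarrow> 'x \<Rightarrow> 'x measure) \<Rightarrow> nat \<Rightarrow> (int \<Rightarrow> 'y) \<Rightarrow> 'x \<Rightarrow> 'x measure" where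
  "kernel_iter MX Q 0 \<omega> = return MX"
| "kernel_iter MX Q (Suc n) \<omega> = (\<lambda>x. Q \<omega> x \<bind> kernel_iter MX Q n (lshift 1 \<omega>))"

text \<open>The property is imposed along the entire two-sided orbit, so that it is inherited by
  every shift of \<omega>.\<close>

definition carried :: "((int \<Rightarrow> 'y) \<Rightarrow> 'x set) \<Rightarrow> ((int \<Rightarrow> 'y) \<Rightarrow> 'x \<Rightarrow> 'x measure) \<Rightarrow> (int \<Rightarrow> 'y) \<Rightarrow> bool" where
  "carried X Q \<omega> \<longleftrightarrow> (\<forall>k. \<forall>x\<in>X (lshift k \<omega>). measure (Q (lshift k \<omega>) x) (X (lshift (k + 1) \<omega>)) = 1)"

lemma carried_lshift: "carried X Q \<omega> \<Longrightarrow> carried X Q (lshift k \<omega>)"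
  unfolding carried_def lshift_lshift
  by (intro allI, drule_tac x="ka + k" in spec) (simp add: ac_simps)

text \<open>Deterministic L and d replace the random length and constant of the Doeblin condition.
  The minorizing measure is existential because the contraction factor does not depend on which one
  it is.\<close>

definition minorized ::
  "'x measure \<Rightarrow> ((int \<Rightarrow> 'y) \<Rightarrow> 'x set) \<Rightarrow> ((int \<Rightarrow> 'y) \<Rightarrow> 'x \<Rightarrow> 'x measure) \<Rightarrow> nat \<Rightarrow> real \<Rightarrow> (int \<Rightarrow> 'y) \<Rightarrow> bool" where
  "minorized MX X Q L d \<omega> \<longleftrightarrow> (\<exists>n\<le>L. \<exists>m\<in>space (prob_algebra MX). measure m (X \<omega>) = 1 \<and>
     (\<forall>x\<in>X (lshift (- int n) \<omega>). \<forall>\<Gamma>\<in>sets MX. \<Gamma> \<subseteq> X \<omega> \<longrightarrow>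
        d * measure m \<Gamma> \<le> measure (kernel_iter MX Q n (lshift (- int n) \<omega>) x) \<Gamma>))"

text \<open>\<^term>\<open>A\<close> will consist of environments in which a minorized block of length at most \<^term>\<open>L\<close>
  ends at time 0; the product bounds the contraction of the \<^term>\<open>n\<close>-step kernel.\<close>

definition decay :: "(int \<Rightarrow> 'y) set \<Rightarrow> nat \<Rightarrow> real \<Rightarrow> nat \<Rightarrow> (int \<Rightarrow> 'y) \<Rightarrow> real" where
  "decay A L d n \<omega> = (\<Prod>i = 1..n div L. 1 - d * indicator A (lshift (int (i * L)) \<omega>))"

section \<open>Iterated kernels: measurability, composition and carriers\<close>

locale markov_environment =
  fixes MY :: "'y measure" and MX :: "'x measure" and X :: "(int \<Rightarrow> 'y) \<Rightarrow> 'x set"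
    and Q :: "(int \<Rightarrow> 'y) \<Rightarrow> 'x \<Rightarrow> 'x measure"
  assumes X_graph: "Sigma (space (path_space MY)) X \<in> sets (path_space MY \<Otimes>\<^sub>M MX)"
    and Q_measurable: "(\<lambda>(\<omega>, x). Q \<omega> x) \<in> path_space MY \<Otimes>\<^sub>M MX \<rightarrow>\<^sub>M prob_algebra MX"
begin

abbreviation "kern \<equiv> kernel_iter MX Q"

lemma X_sets: "\<omega> \<in> space (path_space MY) \<Longrightarrow> X \<omega> \<in> sets MX"
  using sets_Pair1[OF X_graph, of \<omega>] by (simp add: vimage_def)

lemma X_space: "\<omega> \<in> space (path_space MY) \<Longrightarrow> x \<in> X \<omega> \<Longrightarrow> x \<in> space MX"
  using X_sets sets.sets_into_space by blast

lemma Q_section: "\<omega> \<in> space (path_space MY) \<Longrightarrow> Q \<omega> \<in> MX \<rightarrow>\<^sub>M prob_algebra MX"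
  using measurable_Pair2[OF Q_measurable, of \<omega>] by simp

text \<open>Measurability jointly in the environment and the state is what later makes the pullback
  measures measurable in \<omega>; measurability in the state alone would not give this.\<close>

lemma kern_measurable: "(\<lambda>(\<omega>, x). kern n \<omega> x) \<in> path_space MY \<Otimes>\<^sub>M MX \<rightarrow>\<^sub>M prob_algebra MX"
proof (induction n)
  case 0
  show ?case using measurable_compose[OF measurable_snd measurable_return_prob_space, of "path_space MY" MX]
    by (simp add: case_prod_beta')
next
  case (Suc n)
  have "(\<lambda>p. ((\<lambda>(\<omega>, x). kern n \<omega> x) (lshift 1 (fst (fst p)), snd p))) \<in> (path_space MY \<Otimes>\<^sub>M MX) \<Otimes>\<^sub>M MX \<rightarrow>\<^sub>M prob_algebra MX"
    by (rule measurable_compose[OF _ Suc]) measurable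
  then show ?case
    unfolding kernel_iter.simps case_prod_beta'
    by (intro measurable_bind_prob_space2[where N=MX] Q_measurable[unfolded case_prod_beta'])
      (simp add: case_prod_beta')
qed

lemma kern_section: "\<omega> \<in> space (path_space MY) \<Longrightarrow> kern n \<omega> \<in> MX \<rightarrow>\<^sub>M prob_algebra MX"
  using measurable_Pair2[OF kern_measurable, of \<omega>] by simp

lemma kern_space: "\<omega> \<in> space (path_space MY) \<Longrightarrow> x \<in> space MX \<Longrightarrow> kern n \<omega> x \<in> space (prob_algebra MX)"
  by (rule measurable_space[OF kern_section])

lemma bind_space:
  assumes "\<alpha> \<in> space (prob_algebra MX)" "K \<in> MX \<rightarrow>\<^sub>M prob_algebra MX"
  shows "\<alpha> \<bind> K \<in> space (prob_algebra MX)"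
  using prob_space_bind'[OF assms] sets_bind'[OF assms] by (simp add: space_prob_algebra)

lemma bind_assoc':
  assumes "\<alpha> \<in> space (prob_algebra MX)" "K \<in> MX \<rightarrow>\<^sub>M prob_algebra MX" "K' \<in> MX \<rightarrow>\<^sub>M prob_algebra MX"
  shows "\<alpha> \<bind> K \<bind> K' = \<alpha> \<bind> (\<lambda>x. K x \<bind> K')"
  using assms
  by (intro bind_assoc[where N=MX and R=MX] measurable_prob_algebraD)
     (auto simp: space_prob_algebra cong: measurable_cong_sets)

lemma bind_cong':
  assumes "\<alpha> \<in> space (prob_algebra MX)" "\<And>x. x \<in> space MX \<Longrightarrow> K x = K' x"
  shows "\<alpha> \<bind> K = \<alpha> \<bind> K'"
  using assms sets_eq_imp_space_eq[of \<alpha> MX] by (intro bind_cong) (auto simp: space_prob_algebra)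

lemma kern_add:
  assumes "\<omega> \<in> space (path_space MY)" "x \<in> space MX"
  shows "kern (n + l) \<omega> x = kern n \<omega> x \<bind> kern l (lshift (int n) \<omega>)"
  using assms
proof (induction n arbitrary: \<omega> x)
  case 0
  then show ?case
    using bind_return[OF measurable_prob_algebraD[OF kern_section], of \<omega> x l] by simp
next
  case (Suc n)
  have w: "lshift 1 \<omega> \<in> space (path_space MY)" "lshift (int (Suc n)) \<omega> \<in> space (path_space MY)"
    using Suc.prems lshift_space by auto
  have q: "Q \<omega> x \<in> space (prob_algebra MX)" using measurable_space[OF Q_section] Suc.prems by blast
  have "kern (Suc n + l) \<omega> x = Q \<omega> x \<bind> (\<lambda>y. kern n (lshift 1 \<omega>) y \<bind> kern l (lshift (int (Suc n)) \<omega>))"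
    using Suc.IH[OF w(1)] by (auto intro!: bind_cong'[OF q] simp: add.commute)
  also have "\<dots> = kern (Suc n) \<omega> x \<bind> kern l (lshift (int (Suc n)) \<omega>)"
    using bind_assoc'[OF q kern_section kern_section, OF w] by simp
  finally show ?case .
qed

lemma integral_kern_add:
  fixes f :: "'x \<Rightarrow> real"
  assumes w: "\<omega> \<in> space (path_space MY)" "x \<in> space MX"
    and f: "f \<in> borel_measurable MX" and B: "\<And>x. x \<in> space MX \<Longrightarrow> \<bar>f x\<bar> \<le> B"
  shows "(LINT y|kern (n + l) \<omega> x. f y) = (LINT z|kern n \<omega> x. LINT y|kern l (lshift (int n) \<omega>) z. f y)"
  unfolding kern_add[OF w]
  by (rule integral_bind_bounded[OF kern_space[OF w] kern_section f B]) (use w lshift_space in auto)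

lemma bind_full:
  assumes \<alpha>: "\<alpha> \<in> space (prob_algebra MX)" "A \<in> sets MX" "measure \<alpha> A = 1"
    and K: "K \<in> MX \<rightarrow>\<^sub>M prob_algebra MX" "B \<in> sets MX" "\<And>x. x \<in> A \<Longrightarrow> measure (K x) B = 1"
  shows "measure (\<alpha> \<bind> K) B = 1"
proof -
  have "AE x in \<alpha>. emeasure (K x) B = 1"
    using prob_algebra_AE_full[OF \<alpha>] AE_space
  proof eventually_elim
    case (elim x)
    then have "K x \<in> space (prob_algebra MX)"
      using \<alpha> K measurable_space[OF K(1)] sets.sets_into_space by blast
    then interpret prob_space "K x" by (simp add: space_prob_algebra)
    show ?case using K(3) elim by (simp add: emeasure_eq_measure)
  qed
  then have "emeasure (\<alpha> \<bind> K) B = (\<integral>\<^sup>+x. 1 \<partial>\<alpha>)"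
    unfolding emeasure_bind_prob_algebra[OF \<alpha>(1) K(1,2)] by (intro nn_integral_cong_AE)
  also have "\<dots> = 1" using \<alpha> prob_space.emeasure_space_1 by (auto simp: space_prob_algebra)
  finally show ?thesis by (simp add: measure_def)
qed

lemma kern_full:
  assumes "\<omega> \<in> space (path_space MY)" "carried X Q \<omega>" "x \<in> X \<omega>"
  shows "measure (kern n \<omega> x) (X (lshift (int n) \<omega>)) = 1"
  using assms
proof (induction n arbitrary: \<omega> x)
  case 0
  then show ?case using X_sets by (simp add: measure_return)
next
  case (Suc n)
  have w: "lshift 1 \<omega> \<in> space (path_space MY)" "lshift (int (Suc n)) \<omega> \<in> space (path_space MY)"
    using Suc.prems lshift_space by auto
  have q: "Q \<omega> x \<in> space (prob_algebra MX)" using measurable_space[OF Q_section] Suc.prems X_space by blast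
  have 1: "measure (Q \<omega> x) (X (lshift 1 \<omega>)) = 1"
    using Suc.prems(2,3) unfolding carried_def by (elim allE[of _ "0::int"]) simp
  have "measure (kern n (lshift 1 \<omega>) y) (X (lshift (int (Suc n)) \<omega>)) = 1" if "y \<in> X (lshift 1 \<omega>)" for y
    using Suc.IH[OF w(1) carried_lshift that] Suc.prems by (simp add: add.commute)
  then show ?case
    using bind_full[OF q X_sets 1 kern_section X_sets] w by simp
qed

lemma kern_integral:
  fixes f :: "'x \<Rightarrow> real"
  assumes w: "\<omega> \<in> space (path_space MY)"
    and f: "f \<in> borel_measurable MX" and B: "\<And>x. x \<in> space MX \<Longrightarrow> \<bar>f x\<bar> \<le> B"
  shows "(\<lambda>x. LINT y|kern n \<omega> x. f y) \<in> borel_measurable MX"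
    and "x \<in> space MX \<Longrightarrow> \<bar>LINT y|kern n \<omega> x. f y\<bar> \<le> B"
  using kernel_integral_measurable[OF kern_section[OF w] f] prob_algebra_integral_bounded[OF kern_space[OF w] f B]
  by auto

section \<open>Contraction of oscillations along one orbit\<close>

lemma kern_oscillation_le:
  fixes f :: "'x \<Rightarrow> real"
  assumes w: "\<omega> \<in> space (path_space MY)" "carried X Q \<omega>"
    and f: "f \<in> borel_measurable MX" and B: "\<And>x. x \<in> space MX \<Longrightarrow> \<bar>f x\<bar> \<le> B"
    and c: "\<And>x y. x \<in> X (lshift (int n) \<omega>) \<Longrightarrow> y \<in> X (lshift (int n) \<omega>) \<Longrightarrow> f x - f y \<le> c"
    and xy: "x \<in> X \<omega>" "y \<in> X \<omega>"
  shows "(LINT z|kern n \<omega> x. f z) - (LINT z|kern n \<omega> y. f z) \<le> c"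
  by (rule integral_diff_le_oscillation[OF kern_space kern_space X_sets kern_full kern_full f B c])
     (use w xy X_space lshift_space in simp_all)

text \<open>The n steps provided by \<open>minorized\<close> are the last of the L steps. They act
  on f first and contract it; the preceding \<open>L - n\<close> steps act on the resulting function
  and cannot increase its oscillation.\<close>

lemma kern_block_contraction:
  fixes f :: "'x \<Rightarrow> real"
  assumes w: "\<omega> \<in> space (path_space MY)" "carried X Q \<omega>" and d: "0 \<le> d"
    and min: "minorized MX X Q L d (lshift (int L) \<omega>)"
    and f: "f \<in> borel_measurable MX" and B: "\<And>x. x \<in> space MX \<Longrightarrow> \<bar>f x\<bar> \<le> B"
    and c: "\<And>x y. x \<in> X (lshift (int L) \<omega>) \<Longrightarrow> y \<in> X (lshift (int L) \<omega>) \<Longrightarrow> f x - f y \<le> c"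
    and xy: "x \<in> X \<omega>" "y \<in> X \<omega>"
  shows "(LINT z|kern L \<omega> x. f z) - (LINT z|kern L \<omega> y. f z) \<le> (1 - d) * c"
proof -
  obtain n m where n: "n \<le> L" and m: "m \<in> space (prob_algebra MX)" "measure m (X (lshift (int L) \<omega>)) = 1"
    and le: "\<And>x \<Gamma>. x \<in> X (lshift (- int n) (lshift (int L) \<omega>)) \<Longrightarrow> \<Gamma> \<in> sets MX \<Longrightarrow> \<Gamma> \<subseteq> X (lshift (int L) \<omega>) \<Longrightarrow>
        d * measure m \<Gamma> \<le> measure (kern n (lshift (- int n) (lshift (int L) \<omega>)) x) \<Gamma>"
    using min unfolding minorized_def by blast
  define \<omega>' where "\<omega>' = lshift (int (L - n)) \<omega>"
  have w': "\<omega>' \<in> space (path_space MY)" "carried X Q \<omega>'" using w lshift_space carried_lshift by (auto simp: \<omega>'_def)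
  have bwd: "lshift (- int n) (lshift (int L) \<omega>) = \<omega>'" using n by (simp add: \<omega>'_def of_nat_diff)
  have fwd: "lshift (int n) \<omega>' = lshift (int L) \<omega>" using n by (simp add: \<omega>'_def of_nat_diff)
  have XL: "X (lshift (int L) \<omega>) \<in> sets MX" using w lshift_space X_sets by blast
  define g where "g z = (LINT y|kern n \<omega>' z. f y)" for z
  have osc: "g u - g v \<le> (1 - d) * c" if "u \<in> X \<omega>'" "v \<in> X \<omega>'" for u v
    unfolding g_def
  proof (rule minorized_contraction[OF _ _ m(1) XL _ _ m(2) d _ _ f B c])
    show "kern n \<omega>' u \<in> space (prob_algebra MX)" "kern n \<omega>' v \<in> space (prob_algebra MX)"
      using kern_space X_space w' that by blast+
    show "measure (kern n \<omega>' u) (X (lshift (int L) \<omega>)) = 1" "measure (kern n \<omega>' v) (X (lshift (int L) \<omega>)) = 1"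
      using kern_full[OF w', of _ n] that fwd by auto
  qed (use le that bwd in auto)
  have g: "g \<in> borel_measurable MX" "\<And>x. x \<in> space MX \<Longrightarrow> \<bar>g x\<bar> \<le> B"
    unfolding g_def using kern_integral[OF w'(1) f B] by auto
  have "(LINT z|kern L \<omega> x. f z) = (LINT z|kern (L - n) \<omega> x. g z)" if "x \<in> X \<omega>" for x
    using integral_kern_add[OF w(1) X_space[OF w(1) that] f B, of "L - n" n] n by (simp add: g_def \<omega>'_def)
  moreover have "(LINT z|kern (L - n) \<omega> x. g z) - (LINT z|kern (L - n) \<omega> y. g z) \<le> (1 - d) * c"
    using osc by (intro kern_oscillation_le[OF w g _ xy]) (auto simp: \<omega>'_def)
  ultimately show ?thesis using xy by simp
qed

text \<open>The operators act on f from the latest time backwards, so the induction peels off the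
  latest block: f is replaced by its image under that block and c by the contracted bound. The start
  \<omega> stays fixed, which keeps the blocks at multiples of L.\<close>

lemma kern_decay_blocks:
  fixes f :: "'x \<Rightarrow> real"
  assumes w: "\<omega> \<in> space (path_space MY)" "carried X Q \<omega>" and d: "0 \<le> d"
    and min: "\<And>k. lshift k \<omega> \<in> A \<Longrightarrow> minorized MX X Q L d (lshift k \<omega>)"
    and f: "f \<in> borel_measurable MX" and B: "\<And>x. x \<in> space MX \<Longrightarrow> \<bar>f x\<bar> \<le> B"
    and c: "\<And>x y. x \<in> X (lshift (int (m * L)) \<omega>) \<Longrightarrow> y \<in> X (lshift (int (m * L)) \<omega>) \<Longrightarrow> f x - f y \<le> c"
    and xy: "x \<in> X \<omega>" "y \<in> X \<omega>"
  shows "(LINT z|kern (m * L) \<omega> x. f z) - (LINT z|kern (m * L) \<omega> y. f z)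
           \<le> (\<Prod>i = 1..m. 1 - d * indicator A (lshift (int (i * L)) \<omega>)) * c"
  using f B c
proof (induction m arbitrary: f c)
  case 0
  then show ?case using xy integral_return[of _ MX f] X_space[OF w(1)] by simp
next
  case (Suc m)
  define \<omega>' where "\<omega>' = lshift (int (m * L)) \<omega>"
  have w': "\<omega>' \<in> space (path_space MY)" "carried X Q \<omega>'" using w lshift_space carried_lshift by (auto simp: \<omega>'_def)
  have fwd: "lshift (int L) \<omega>' = lshift (int (Suc m * L)) \<omega>" by (simp add: \<omega>'_def)
  define g where "g z = (LINT y|kern L \<omega>' z. f y)" for z
  have g: "g \<in> borel_measurable MX" "\<And>x. x \<in> space MX \<Longrightarrow> \<bar>g x\<bar> \<le> B"
    unfolding g_def using kern_integral[OF w'(1) Suc.prems(1,2)] by auto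
  define r where "r = (1 - d * indicator A (lshift (int (Suc m * L)) \<omega>) :: real)"
  have osc: "g u - g v \<le> r * c" if uv: "u \<in> X \<omega>'" "v \<in> X \<omega>'" for u v
  proof (cases "lshift (int (Suc m * L)) \<omega> \<in> A")
    case True
    then show ?thesis
      using kern_block_contraction[OF w' d _ Suc.prems(1,2) _ uv, of L c] min[OF True] Suc.prems(3)
      unfolding fwd g_def r_def by auto
  next
    case False
    then show ?thesis
      using kern_oscillation_le[OF w' Suc.prems(1,2) _ uv, of L c] Suc.prems(3)
      unfolding fwd g_def r_def by auto
  qed
  have "(LINT z|kern (Suc m * L) \<omega> x. f z) = (LINT z|kern (m * L) \<omega> x. g z)" if "x \<in> X \<omega>" for x
    using integral_kern_add[OF w(1) X_space[OF w(1) that] Suc.prems(1,2), of "m * L" L]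
    by (simp add: g_def \<omega>'_def add.commute)
  moreover have "(LINT z|kern (m * L) \<omega> x. g z) - (LINT z|kern (m * L) \<omega> y. g z)
      \<le> (\<Prod>i = 1..m. 1 - d * indicator A (lshift (int (i * L)) \<omega>)) * (r * c)"
    using osc by (intro Suc.IH[OF g]) (auto simp: \<omega>'_def)
  moreover have "(\<Prod>i = 1..Suc m. 1 - d * indicator A (lshift (int (i * L)) \<omega>)) =
      (\<Prod>i = 1..m. 1 - d * indicator A (lshift (int (i * L)) \<omega>)) * r"
    unfolding r_def by (simp del: mult_Suc of_nat_mult)
  ultimately show ?case using xy by (simp only: mult.assoc)
qed

text \<open>The \<open>n mod L\<close> surplus steps are placed after the full blocks, so that the
  block ends stay at multiples of L counted from the start, as in \<open>decay\<close>. Only their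
  nonexpansion is used.\<close>

lemma kern_decay:
  fixes f :: "'x \<Rightarrow> real"
  assumes w: "\<omega> \<in> space (path_space MY)" "carried X Q \<omega>" and d: "0 \<le> d"
    and min: "\<And>k. lshift k \<omega> \<in> A \<Longrightarrow> minorized MX X Q L d (lshift k \<omega>)"
    and f: "f \<in> borel_measurable MX" and B: "\<And>x. x \<in> space MX \<Longrightarrow> \<bar>f x\<bar> \<le> B"
    and c: "\<And>x y. x \<in> X (lshift (int n) \<omega>) \<Longrightarrow> y \<in> X (lshift (int n) \<omega>) \<Longrightarrow> f x - f y \<le> c"
    and xy: "x \<in> X \<omega>" "y \<in> X \<omega>"
  shows "(LINT z|kern n \<omega> x. f z) - (LINT z|kern n \<omega> y. f z) \<le> decay A L d n \<omega> * c"
proof -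
  define a where "a = n div L * L"
  define b where "b = n mod L"
  have n: "n = a + b" by (simp add: a_def b_def)
  define \<omega>' where "\<omega>' = lshift (int a) \<omega>"
  have w': "\<omega>' \<in> space (path_space MY)" "carried X Q \<omega>'" using w lshift_space carried_lshift by (auto simp: \<omega>'_def)
  have fwd: "lshift (int b) \<omega>' = lshift (int n) \<omega>" using n by (simp add: \<omega>'_def add.commute)
  define g where "g z = (LINT y|kern b \<omega>' z. f y)" for z
  have g: "g \<in> borel_measurable MX" "\<And>x. x \<in> space MX \<Longrightarrow> \<bar>g x\<bar> \<le> B"
    unfolding g_def using kern_integral[OF w'(1) f B] by auto
  have osc: "g u - g v \<le> c" if "u \<in> X \<omega>'" "v \<in> X \<omega>'" for u v
    unfolding g_def using c that by (intro kern_oscillation_le[OF w' f B]) (auto simp: fwd)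
  have "(LINT z|kern n \<omega> x. f z) = (LINT z|kern a \<omega> x. g z)" if "x \<in> X \<omega>" for x
    using integral_kern_add[OF w(1) X_space[OF w(1) that] f B, of a b] n by (simp add: g_def \<omega>'_def)
  then show ?thesis
    using kern_decay_blocks[OF w d min g _ xy, where m="n div L" and c=c] osc xy
    unfolding decay_def \<omega>'_def a_def by auto
qed

lemma bind_kern_decay:
  fixes f :: "'x \<Rightarrow> real"
  assumes w: "\<omega> \<in> space (path_space MY)" "carried X Q \<omega>" and d: "0 \<le> d"
    and min: "\<And>k. lshift k \<omega> \<in> A \<Longrightarrow> minorized MX X Q L d (lshift k \<omega>)"
    and f: "f \<in> borel_measurable MX" and B: "\<And>x. x \<in> space MX \<Longrightarrow> \<bar>f x\<bar> \<le> 1"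
    and \<alpha>: "\<alpha> \<in> space (prob_algebra MX)" "measure \<alpha> (X \<omega>) = 1"
    and \<beta>: "\<beta> \<in> space (prob_algebra MX)" "measure \<beta> (X \<omega>) = 1"
  shows "\<bar>(LINT x|(\<alpha> \<bind> kern n \<omega>). f x) - (LINT x|(\<beta> \<bind> kern n \<omega>). f x)\<bar> \<le> 2 * decay A L d n \<omega>"
proof -
  \<comment> \<open>A function bounded by 1 in absolute value has oscillation at most 2; this is the
    source of the factor 2 in all later distance bounds.\<close>
  have "f x - f y \<le> 2" if "x \<in> X (lshift (int n) \<omega>)" "y \<in> X (lshift (int n) \<omega>)" for x y
    using B[OF X_space[OF lshift_space[OF w(1)] that(1)]] B[OF X_space[OF lshift_space[OF w(1)] that(2)]] by linarith
  from kern_decay[OF w d min f B this]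
  have *: "(LINT z|kern n \<omega> x. f z) - (LINT z|kern n \<omega> y. f z) \<le> 2 * decay A L d n \<omega>" if "x \<in> X \<omega>" "y \<in> X \<omega>" for x y
    using that by (simp add: mult.commute)
  note g = kern_integral[OF w(1) f B, where n=n]
  have "(LINT x|\<alpha>. LINT y|kern n \<omega> x. f y) - (LINT x|\<beta>. LINT y|kern n \<omega> x. f y) \<le> 2 * decay A L d n \<omega>"
    by (rule integral_diff_le_oscillation[OF \<alpha>(1) \<beta>(1) X_sets[OF w(1)] \<alpha>(2) \<beta>(2) g *])
  moreover have "(LINT x|\<beta>. LINT y|kern n \<omega> x. f y) - (LINT x|\<alpha>. LINT y|kern n \<omega> x. f y) \<le> 2 * decay A L d n \<omega>"
    by (rule integral_diff_le_oscillation[OF \<beta>(1) \<alpha>(1) X_sets[OF w(1)] \<beta>(2) \<alpha>(2) g *])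
  ultimately show ?thesis
    using integral_bind_bounded[OF \<alpha>(1) kern_section[OF w(1)] f B]
      integral_bind_bounded[OF \<beta>(1) kern_section[OF w(1)] f B] by (simp add: abs_le_iff)
qed

lemma invariant_iterate:
  assumes w: "\<omega> \<in> space (path_space MY)"
    and p: "\<And>k. \<mu> (lshift k \<omega>) \<in> space (prob_algebra MX)"
    and inv: "\<And>k. \<mu> (lshift k \<omega>) \<bind> Q (lshift k \<omega>) = \<mu> (lshift (k + 1) \<omega>)"
  shows "\<mu> (lshift k \<omega>) \<bind> kern n (lshift k \<omega>) = \<mu> (lshift (k + int n) \<omega>)"
proof (induction n arbitrary: k)
  case 0
  then show ?case using p by (simp add: space_prob_algebra bind_return'')
next
  case (Suc n)
  have "\<mu> (lshift k \<omega>) \<bind> kern (Suc n) (lshift k \<omega>) = \<mu> (lshift k \<omega>) \<bind> Q (lshift k \<omega>) \<bind> kern n (lshift (k + 1) \<omega>)"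
    using bind_assoc'[OF p Q_section kern_section, OF lshift_space[OF w] lshift_space[OF w]]
    by (simp add: add.commute)
  then show ?case using Suc by (simp add: inv add.assoc)
qed

end

section \<open>Mixing and the expected contraction\<close>

lemma lshift_measurable_law: "sets P = sets (path_space MY) \<Longrightarrow> lshift k \<in> P \<rightarrow>\<^sub>M path_space MY"
  using measurable_cong_sets[of P "path_space MY" "path_space MY" "path_space MY"] lshift_measurable by auto

lemma coord_sigma_sigma_algebra: "sigma_algebra (space (path_space MY)) (coord_sigma MY I)"
  unfolding coord_sigma_def by (rule sigma_algebra_sigma_sets) auto

lemma coord_sigma_mono: "I \<subseteq> J \<Longrightarrow> coord_sigma MY I \<subseteq> coord_sigma MY J"
  unfolding coord_sigma_def by (rule sigma_sets_mono') auto

lemma coord_sigma_sets: "coord_sigma MY I \<subseteq> sets (path_space MY)"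
  unfolding coord_sigma_def
  by (rule sets.sigma_sets_subset) (auto intro!: measurable_sets[OF measurable_component_singleton])

lemma coord_sigma_lshift:
  assumes "A \<in> coord_sigma MY I"
  shows "lshift k -` A \<inter> space (path_space MY) \<in> coord_sigma MY ((\<lambda>i. i + k) ` I)"
  using assms unfolding coord_sigma_def[of MY I]
proof (induction rule: sigma_sets.induct)
  case (Basic a)
  then obtain s B where a: "a = (\<lambda>\<omega>. \<omega> s) -` B \<inter> space (path_space MY)" "s \<in> I" "B \<in> sets MY" by auto
  have "lshift k -` a \<inter> space (path_space MY) = (\<lambda>\<omega>. \<omega> (s + k)) -` B \<inter> space (path_space MY)"
    using lshift_space[of _ MY k] by (auto simp: a lshift_def)
  then show ?case using a unfolding coord_sigma_def by (intro sigma_sets.Basic) auto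
next
  case Empty
  interpret sigma_algebra "space (path_space MY)" "coord_sigma MY ((\<lambda>i. i + k) ` I)" by (rule coord_sigma_sigma_algebra)
  show ?case by simp
next
  case (Compl a)
  interpret sigma_algebra "space (path_space MY)" "coord_sigma MY ((\<lambda>i. i + k) ` I)" by (rule coord_sigma_sigma_algebra)
  have "lshift k -` (space (path_space MY) - a) \<inter> space (path_space MY)
      = space (path_space MY) - (lshift k -` a \<inter> space (path_space MY))"
    using lshift_space[of _ MY k] by auto
  then show ?case using Compl.IH by auto
next
  case (Union a)
  interpret sigma_algebra "space (path_space MY)" "coord_sigma MY ((\<lambda>i. i + k) ` I)" by (rule coord_sigma_sigma_algebra)
  have "lshift k -` (\<Union>i. a i) \<inter> space (path_space MY) = (\<Union>i. lshift k -` a i \<inter> space (path_space MY))"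
    by auto
  then show ?case using Union.IH by (simp only:) (intro countable_UN, auto)
qed

lemma lshift_invariant_path_law:
  assumes "stationary_process N MY Y"
  shows "distr (path_law N MY Y) (path_space MY) (lshift k) = path_law N MY Y"
proof -
  have Y: "\<And>j. Y j \<in> N \<rightarrow>\<^sub>M MY" and st: "path_law N MY (\<lambda>j. Y (j + k)) = path_law N MY Y"
    using assms by (auto simp: stationary_process_def)
  have m: "(\<lambda>x j. Y j x) \<in> N \<rightarrow>\<^sub>M path_space MY"
    using Y measurable_space[OF Y] by (intro measurable_PiM_single') auto
  have "distr (path_law N MY Y) (path_space MY) (lshift k) = path_law N MY (\<lambda>j. Y (j + k))"
    unfolding path_law_def by (subst distr_distr[OF lshift_measurable m]) (simp add: comp_def lshift_def)
  then show ?thesis using st by simp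
qed

lemma psi_U_less_1D:
  assumes P: "prob_space P" "sets P = sets (path_space MY)" and psi: "psi_U MY P n < 1"
    and A: "A \<in> coord_sigma MY {..k}" and B: "B \<in> coord_sigma MY {k + int n..}"
  shows "measure P (A \<inter> B) \<le> 2 * measure P A * measure P B"
proof (cases "measure P A * measure P B > 0")
  case True
  have "ereal (measure P (A \<inter> B) / (measure P A * measure P B) - 1) \<le> psi_U MY P n"
    unfolding psi_U_def using A B True by (intro SUP_upper2[of k] SUP_upper2[of "(A, B)"]) auto
  then have "ereal (measure P (A \<inter> B) / (measure P A * measure P B) - 1) < 1" using psi by (rule le_less_trans)
  then have "measure P (A \<inter> B) / (measure P A * measure P B) < 2" by (simp add: one_ereal_def)
  then show ?thesis using True by (simp add: pos_divide_less_eq)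
next
  \<comment> \<open>\<open>psi_U\<close> ranges only over pairs with positive product. If one of the
    two events is null, so is the intersection.\<close>
  case False
  interpret prob_space P by fact
  have s: "A \<in> sets P" "B \<in> sets P" using A B coord_sigma_sets P(2) by auto
  have "prob (A \<inter> B) \<le> prob A" "prob (A \<inter> B) \<le> prob B"
    using s by (auto intro!: finite_measure_mono)
  moreover have "prob A = 0 \<or> prob B = 0" using False measure_nonneg[of P A] measure_nonneg[of P B] by (metis mult_pos_pos order_le_less)
  ultimately show ?thesis by auto
qed

text \<open>Inserting the largest index last keeps all earlier windows in the past of the new one,
  so every insertion costs a single application of the mixing bound, and stationarity gives each new
  window the same probability.\<close>

lemma mixing_intersection_le:
  assumes P: "prob_space P" "sets P = sets (path_space MY)"
    and inv: "\<And>k. distr P (path_space MY) (lshift k) = P"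
    and psi: "psi_U MY P n0 < 1" and B: "B \<in> coord_sigma MY {- int M..0}"
    and L: "L = M + n0" and S: "finite S"
  shows "measure P {\<omega> \<in> space P. \<forall>i\<in>S. lshift (int (i * L)) \<omega> \<in> B} \<le> (2 * measure P B) ^ card S"
  using S
proof (induction rule: finite_linorder_max_induct)
  case empty
  interpret prob_space P by fact
  show ?case by (simp add: prob_space)
next
  case (insert b S)
  interpret prob_space P by fact
  have sp: "space P = space (path_space MY)" using P(2) by (rule sets_eq_imp_space_eq)
  \<comment> \<open>The multiple of L just before \<open>b * L\<close>, hence the latest possible
    end of an earlier window. Since \<open>L = M + n0\<close>, the window ending at
    \<open>b * L\<close> begins exactly at \<open>k + n0\<close>.\<close>
  define k where "k = int (b * L) - int L"
  have sh: "lshift (int (i * L)) -` B \<inter> space (path_space MY) \<in> coord_sigma MY {int (i * L) - int M..int (i * L)}" for i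
    using coord_sigma_lshift[OF B, of "int (i * L)"] by (simp add: image_add_atLeastAtMost')
  let ?D = "{\<omega> \<in> space P. \<forall>i\<in>S. lshift (int (i * L)) \<omega> \<in> B}"
  interpret F: sigma_algebra "space (path_space MY)" "coord_sigma MY {..k}" by (rule coord_sigma_sigma_algebra)
  have D: "?D \<in> coord_sigma MY {..k}"
  proof (cases "S = {}")
    \<comment> \<open>An intersection over the empty index set would be \<open>UNIV\<close> rather
      than the path space, hence the separate case.\<close>
    case True
    then show ?thesis using F.top sp by simp
  next
    case False
    have "lshift (int (i * L)) -` B \<inter> space (path_space MY) \<in> coord_sigma MY {..k}" if "i \<in> S" for i
    proof -
      have "i + 1 \<le> b" using insert that by auto
      then have "(i + 1) * L \<le> b * L" by (rule mult_le_mono1)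
      then have "int (i * L) \<le> k" unfolding k_def by (simp add: of_nat_mult[symmetric] del: of_nat_mult)
      then have "coord_sigma MY {int (i * L) - int M..int (i * L)} \<subseteq> coord_sigma MY {..k}"
        by (intro coord_sigma_mono) auto
      then show ?thesis using sh by blast
    qed
    then have "(\<Inter>i\<in>S. lshift (int (i * L)) -` B \<inter> space (path_space MY)) \<in> coord_sigma MY {..k}"
      using insert False by (intro F.finite_INT) auto
    moreover have "?D = (\<Inter>i\<in>S. lshift (int (i * L)) -` B \<inter> space (path_space MY))" using False sp by auto
    ultimately show ?thesis by simp
  qed
  let ?E = "lshift (int (b * L)) -` B \<inter> space (path_space MY)"
  have E: "?E \<in> coord_sigma MY {k + int n0..}"
    using sh[of b] coord_sigma_mono[of "{int (b * L) - int M..int (b * L)}" "{k + int n0..}" MY]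
    by (auto simp: k_def L)
  have "prob ?E = measure (distr P (path_space MY) (lshift (int (b * L)))) B"
    using B coord_sigma_sets sp by (subst measure_distr[OF lshift_measurable_law[OF P(2)]]) auto
  then have pE: "prob ?E = prob B" by (simp add: inv)
  have "{\<omega> \<in> space P. \<forall>i\<in>insert b S. lshift (int (i * L)) \<omega> \<in> B} = ?D \<inter> ?E" using sp by auto
  then have "prob {\<omega> \<in> space P. \<forall>i\<in>insert b S. lshift (int (i * L)) \<omega> \<in> B} \<le> 2 * prob ?D * prob B"
    using psi_U_less_1D[OF P psi D E] pE by simp
  also have "\<dots> \<le> 2 * (2 * prob B) ^ card S * prob B"
    using insert.IH by (intro mult_mono) auto
  also have "\<dots> = (2 * prob B) ^ card (insert b S)" using insert by (subst card_insert_disjoint) auto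
  finally show ?case .
qed

section \<open>Expected contraction and its almost sure envelope\<close>

text \<open>The joint probabilities are dominated as if the events were independent with probability
  b. Because a and d are nonnegative, the expansion over subsets can be estimated term by term, and
  the same product formula resums the bound to a power.\<close>

lemma (in prob_space) expectation_prod_indicator_le:
  fixes B :: "'i \<Rightarrow> 'a set"
  assumes fin: "finite I" and B: "\<And>i. i \<in> I \<Longrightarrow> B i \<in> events"
    and le: "\<And>S. S \<subseteq> I \<Longrightarrow> prob {\<omega> \<in> space M. \<forall>i\<in>S. \<omega> \<in> B i} \<le> b ^ card S"
    and ad: "0 \<le> a" "0 \<le> d"
  shows "expectation (\<lambda>\<omega>. \<Prod>i\<in>I. d * indicator (B i) \<omega> + a) \<le> (d * b + a) ^ card I"
proof -
  let ?E = "\<lambda>S. {\<omega> \<in> space M. \<forall>i\<in>S. \<omega> \<in> B i}"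
  have E: "?E S \<in> events" if "S \<subseteq> I" for S
  proof (rule sets.sets_Collect_finite_All)
    fix i assume "i \<in> S"
    then have "B i \<in> events" using B that by auto
    moreover from this have "{\<omega> \<in> space M. \<omega> \<in> B i} = B i" using sets.sets_into_space by auto
    ultimately show "{\<omega> \<in> space M. \<omega> \<in> B i} \<in> events" by simp
  qed (use that fin finite_subset in auto)
  have ind: "(\<Prod>i\<in>S. indicator (B i) \<omega> :: real) = indicator (?E S) \<omega>" if "S \<subseteq> I" "\<omega> \<in> space M" for S \<omega>
  proof -
    have "finite S" using that fin finite_subset by auto
    then show ?thesis using that by induction (auto simp: indicator_def)
  qed
  have "expectation (\<lambda>\<omega>. \<Prod>i\<in>I. d * indicator (B i) \<omega> + a)
      = expectation (\<lambda>\<omega>. \<Sum>S\<in>Pow I. d ^ card S * a ^ card (I - S) * indicator (?E S) \<omega>)"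
  proof (intro Bochner_Integration.integral_cong refl)
    fix \<omega> assume \<omega>: "\<omega> \<in> space M"
    show "(\<Prod>i\<in>I. d * indicator (B i) \<omega> + a) = (\<Sum>S\<in>Pow I. d ^ card S * a ^ card (I - S) * indicator (?E S) \<omega>)"
      unfolding prod_add[OF fin]
    proof (intro sum.cong refl)
      fix S assume "S \<in> Pow I"
      then show "(\<Prod>i\<in>S. d * indicator (B i) \<omega>) * (\<Prod>i\<in>I - S. a) = d ^ card S * a ^ card (I - S) * indicator (?E S) \<omega>"
        using \<omega> by (simp only: prod.distrib prod_constant ind Pow_iff mult.assoc mult.commute mult.left_commute)
    qed
  qed
  also have "\<dots> = (\<Sum>S\<in>Pow I. d ^ card S * a ^ card (I - S) * prob (?E S))"
    using E by (subst Bochner_Integration.integral_sum) (auto simp: emeasure_eq_measure)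
  also have "\<dots> \<le> (\<Sum>S\<in>Pow I. d ^ card S * a ^ card (I - S) * b ^ card S)"
    using le ad by (intro sum_mono mult_left_mono) auto
  also have "\<dots> = (\<Sum>S\<in>Pow I. (\<Prod>i\<in>S. d * b) * (\<Prod>i\<in>I - S. a))"
    by (intro sum.cong) (auto simp: power_mult_distrib)
  also have "\<dots> = (d * b + a) ^ card I" using prod_add[OF fin, of "\<lambda>_. d * b" "\<lambda>_. a"] by simp
  finally show ?thesis .
qed

lemma decay_bounds:
  assumes "0 \<le> d" "d \<le> 1"
  shows "0 \<le> decay A L d n \<omega>" "decay A L d n \<omega> \<le> 1"
  unfolding decay_def using assms
  by (auto intro!: prod_nonneg prod_le_1 simp: indicator_def)

lemma decay_measurable:
  assumes A: "A \<in> sets (path_space MY)"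
  shows "decay A L d n \<in> borel_measurable (path_space MY)"
proof -
  have "(\<lambda>\<omega>. indicator A (lshift k \<omega>) :: real) \<in> borel_measurable (path_space MY)" for k
    using A by (intro measurable_compose[OF lshift_measurable] borel_measurable_indicator)
  then show ?thesis unfolding decay_def[abs_def] by measurable
qed

lemma expectation_decay_le:
  assumes P: "prob_space P" "sets P = sets (path_space MY)"
    and inv: "\<And>k. distr P (path_space MY) (lshift k) = P"
    and psi: "psi_U MY P n0 < 1" and A: "A \<in> coord_sigma MY {- int M..0}"
    and L: "L = M + n0" and d: "0 \<le> d" "d \<le> 1" and pA: "measure P A \<ge> 3 / 4"
  shows "(LINT \<omega>|P. decay A L d n \<omega>) \<le> (1 - d / 2) ^ (n div L)"
proof -
  interpret prob_space P by fact
  have sp: "space P = space (path_space MY)" using P(2) by (rule sets_eq_imp_space_eq)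
  define B where "B = space P - A"
  interpret F: sigma_algebra "space (path_space MY)" "coord_sigma MY {- int M..0}" by (rule coord_sigma_sigma_algebra)
  have B: "B \<in> coord_sigma MY {- int M..0}" using A by (auto simp: B_def sp)
  have AP: "A \<in> events" using A coord_sigma_sets P(2) by auto
  have pB: "prob B \<le> 1/4" using prob_compl[OF AP] pA by (simp add: B_def)
  let ?B = "\<lambda>i. lshift (int (i * L)) -` B \<inter> space P"
  have BP: "?B i \<in> events" for i
    using B coord_sigma_sets by (intro measurable_sets[OF lshift_measurable_law[OF P(2)]]) auto
  have ex: "{\<omega> \<in> space P. \<forall>i\<in>S. \<omega> \<in> ?B i} = {\<omega> \<in> space P. \<forall>i\<in>S. lshift (int (i * L)) \<omega> \<in> B}" for S by auto
  \<comment> \<open>With B the complement of A, each factor becomes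
    \<open>d * indicator B + (1 - d)\<close>, where both coefficients are nonnegative.\<close>
  have "(LINT \<omega>|P. decay A L d n \<omega>) = expectation (\<lambda>\<omega>. \<Prod>i = 1..n div L. d * indicator (?B i) \<omega> + (1 - d))"
    unfolding decay_def using lshift_space sp
    by (intro Bochner_Integration.integral_cong prod.cong refl) (auto simp: indicator_def B_def)
  also have "\<dots> \<le> (d * (2 * prob B) + (1 - d)) ^ card {1..n div L}"
  proof (rule expectation_prod_indicator_le)
    fix S assume "S \<subseteq> {1..n div L}"
    then have "finite S" by (rule finite_subset) simp
    then show "prob {\<omega> \<in> space P. \<forall>i\<in>S. \<omega> \<in> ?B i} \<le> (2 * prob B) ^ card S"
      unfolding ex by (rule mixing_intersection_le[OF P inv psi B L])
  qed (use d BP in auto)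
  also have "\<dots> \<le> (1 - d / 2) ^ card {1..n div L}"
  proof (rule power_mono)
    \<comment> \<open>Here \<open>2 * prob B\<close> is at most 1/2, so mixing costs half of the
      contraction d.\<close>
    show "d * (2 * prob B) + (1 - d) \<le> 1 - d / 2" using mult_left_mono[OF pB d(1)] by simp
  qed (use d in auto)
  finally show ?thesis by simp
qed

text \<open>Weighting \<open>v n\<close> by the inverse of \<open>\<rho> ^ n\<close> spends half of
  the exponential rate and leaves a geometric series of expectations. The weighted sum is thus
  integrable, and it dominates each of its nonnegative terms.\<close>

lemma (in prob_space) exponential_envelope:
  fixes v :: "nat \<Rightarrow> 'a \<Rightarrow> real"
  assumes v: "\<And>n. v n \<in> borel_measurable M" "\<And>n \<omega>. 0 \<le> v n \<omega>" "\<And>n \<omega>. v n \<omega> \<le> 1"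
    and le: "\<And>n. expectation (v n) \<le> C * (\<rho>\<^sup>2) ^ n" and \<rho>: "0 < \<rho>" "\<rho> < 1"
  shows "\<exists>S. integrable M S \<and> (\<forall>\<omega>. (0::real) \<le> S \<omega>) \<and> (AE \<omega> in M. \<forall>n. v n \<omega> \<le> \<rho> ^ n * S \<omega>)"
proof -
  define s where "s \<omega> = (\<Sum>n. ennreal (v n \<omega> / \<rho> ^ n))" for \<omega>
  have sm: "s \<in> borel_measurable M" unfolding s_def using v by measurable
  have C: "0 \<le> C" using le[of 0] integral_nonneg_AE[of "v 0" M] v by fastforce
  have term_le: "(\<integral>\<^sup>+\<omega>. ennreal (v n \<omega> / \<rho> ^ n) \<partial>M) \<le> ennreal (C * \<rho> ^ n)" for n
  proof -
    have i: "integrable M (v n)" using v by (intro integrable_const_bound[where B=1]) auto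
    have "(\<integral>\<^sup>+\<omega>. ennreal (v n \<omega> / \<rho> ^ n) \<partial>M) = ennreal (expectation (v n) / \<rho> ^ n)"
      using i v \<rho> by (subst nn_integral_eq_integral) auto
    also have "\<dots> \<le> ennreal (C * (\<rho>\<^sup>2) ^ n / \<rho> ^ n)"
      using le[of n] \<rho> by (intro ennreal_leI divide_right_mono) auto
    also have "C * (\<rho>\<^sup>2) ^ n / \<rho> ^ n = C * \<rho> ^ n" using \<rho> by (simp add: power2_eq_square power_mult_distrib)
    finally show ?thesis .
  qed
  have sumC: "summable (\<lambda>n. C * \<rho> ^ n)" using \<rho> by (intro summable_mult summable_geometric) auto
  have "(\<integral>\<^sup>+\<omega>. s \<omega> \<partial>M) = (\<Sum>n. \<integral>\<^sup>+\<omega>. ennreal (v n \<omega> / \<rho> ^ n) \<partial>M)"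
    unfolding s_def using v by (intro nn_integral_suminf) auto
  also have "\<dots> \<le> (\<Sum>n. ennreal (C * \<rho> ^ n))" by (intro suminf_le term_le) auto
  also have "\<dots> = ennreal (\<Sum>n. C * \<rho> ^ n)" using sumC C \<rho> by (intro suminf_ennreal2) auto
  finally have fin: "(\<integral>\<^sup>+\<omega>. s \<omega> \<partial>M) < \<infinity>" by (simp add: le_less_trans)
  have ae: "AE \<omega> in M. s \<omega> \<noteq> \<infinity>" using fin sm by (intro nn_integral_PInf_AE) auto
  \<comment> \<open>\<open>enn2real\<close> sends an infinite sum to 0. This keeps the envelope real
    and nonnegative everywhere and spoils the bound only on the null set where the series
    diverges.\<close>
  let ?S = "\<lambda>\<omega>. enn2real (s \<omega>)"
  have "(\<integral>\<^sup>+\<omega>. ennreal (?S \<omega>) \<partial>M) \<le> (\<integral>\<^sup>+\<omega>. s \<omega> \<partial>M)" by (intro nn_integral_mono) (simp add: ennreal_enn2real_if)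
  then have "integrable M ?S"
    using sm fin by (intro integrableI_bounded) (auto simp: le_less_trans)
  moreover have "AE \<omega> in M. \<forall>n. v n \<omega> \<le> \<rho> ^ n * ?S \<omega>"
    using ae
  proof eventually_elim
    case (elim \<omega>)
    show ?case
    proof
      fix n
      have "ennreal (v n \<omega> / \<rho> ^ n) \<le> s \<omega>"
        unfolding s_def using sum_le_suminf[of "\<lambda>n. ennreal (v n \<omega> / \<rho> ^ n)" "{n}"] by auto
      also have "s \<omega> = ennreal (?S \<omega>)" using elim by (simp add: less_top)
      finally have "v n \<omega> / \<rho> ^ n \<le> ?S \<omega>" by (simp add: ennreal_le_iff)
      then show "v n \<omega> \<le> \<rho> ^ n * ?S \<omega>" using \<rho> by (simp add: pos_divide_le_eq mult.commute)
    qed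
  qed
  ultimately show ?thesis by (intro exI[of _ ?S]) auto
qed

lemma decay_rate:
  assumes P: "prob_space P" "sets P = sets (path_space MY)"
    and inv: "\<And>k. distr P (path_space MY) (lshift k) = P"
    and psi: "psi_U MY P n0 < 1" and A: "A \<in> coord_sigma MY {- int M..0}"
    and L: "L = M + n0" "0 < L" and d: "0 < d" "d < 1" and pA: "measure P A \<ge> 3 / 4"
  shows "\<exists>\<rho> S. 0 < \<rho> \<and> \<rho> < (1::real) \<and> integrable P S \<and> (\<forall>\<omega>. (0::real) \<le> S \<omega>) \<and>
     (AE \<omega> in P. \<forall>n. decay A L d n \<omega> \<le> \<rho> ^ n * S \<omega> \<and> decay A L d n (lshift (- int n) \<omega>) \<le> \<rho> ^ n * S \<omega>)"
proof -
  interpret prob_space P by fact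
  define q where "q = 1 - d / 2"
  have q: "0 < q" "q < 1" using d by (auto simp: q_def)
  \<comment> \<open>The square of \<rho> is \<open>q powr (1 / L)\<close>, the rate per step that
    corresponds to a factor q per block; the extra square root is the half of the rate spent in
    \<open>exponential_envelope\<close>.\<close>
  define \<rho> where "\<rho> = q powr (1 / (2 * L))"
  have \<rho>: "0 < \<rho>" "\<rho> < 1"
    using q L(2) powr_less_mono2[of "1 / (2 * L)" q 1] unfolding \<rho>_def by auto
  \<comment> \<open>Replacing \<open>n div L\<close> by \<open>n / L\<close> loses at most one
    block, hence the constant \<open>1 / q\<close>.\<close>
  have rate: "q ^ (n div L) \<le> (1 / q) * (\<rho>\<^sup>2) ^ n" for n
  proof -
    have "n < (n div L + 1) * L" using L by (simp add: dividend_less_div_times)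
    then have "real n < real ((n div L + 1) * L)" by (simp only: of_nat_less_iff)
    then have "real n / L \<le> n div L + 1" using L(2) by (simp add: pos_divide_le_eq distrib_right)
    then have "q powr (n div L + 1) \<le> q powr (real n / L)" using q by (intro powr_mono') auto
    also have "\<dots> = (\<rho>\<^sup>2) ^ n" using q L(2) by (simp add: \<rho>_def powr_power power_mult[symmetric] field_simps)
    also have "q powr (n div L + 1) = q * q ^ (n div L)" using q by (simp add: powr_add powr_realpow)
    finally show ?thesis using q by (simp add: field_simps)
  qed
  have AP: "A \<in> sets (path_space MY)" using A coord_sigma_sets by auto
  have v: "decay A L d n \<in> borel_measurable P" for n
    by (subst measurable_cong_sets[OF P(2) refl]) (rule decay_measurable[OF AP])
  note sh = lshift_measurable_law[OF P(2)]
  have v': "(\<lambda>\<omega>. decay A L d n (lshift k \<omega>)) \<in> borel_measurable P" for n k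
    using measurable_compose[OF sh decay_measurable[OF AP]] .
  have e: "expectation (decay A L d n) \<le> (1 / q) * (\<rho>\<^sup>2) ^ n" for n
    using expectation_decay_le[OF P inv psi A L(1) _ _ pA, of d n] d rate[of n] by (auto simp: q_def)
  \<comment> \<open>By invariance of the law the starting time does not matter in expectation. The
    pullback products therefore have the forward rate, although their starting time moves with
    n.\<close>
  have "expectation (\<lambda>\<omega>. decay A L d n (lshift k \<omega>)) = expectation (decay A L d n)" for n k
    using integral_distr[OF sh decay_measurable[OF AP], of k L d n] by (simp add: inv)
  then have e': "expectation (\<lambda>\<omega>. decay A L d n (lshift k \<omega>)) \<le> (1 / q) * (\<rho>\<^sup>2) ^ n" for n k using e by simp
  note b = decay_bounds[OF less_imp_le[OF d(1)] less_imp_le[OF d(2)]]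
  obtain S where S: "integrable P S" "\<And>\<omega>. 0 \<le> S \<omega>" "AE \<omega> in P. \<forall>n. decay A L d n \<omega> \<le> \<rho> ^ n * S \<omega>"
    using exponential_envelope[of "decay A L d", OF v b e \<rho>] by blast
  obtain S' where S': "integrable P S'" "\<And>\<omega>. 0 \<le> S' \<omega>"
    "AE \<omega> in P. \<forall>n. decay A L d n (lshift (- int n) \<omega>) \<le> \<rho> ^ n * S' \<omega>"
    using exponential_envelope[of "\<lambda>n \<omega>. decay A L d n (lshift (- int n) \<omega>)", OF v' b e' \<rho>] by blast
  have "AE \<omega> in P. \<forall>n. decay A L d n \<omega> \<le> \<rho> ^ n * (S \<omega> + S' \<omega>) \<and>
      decay A L d n (lshift (- int n) \<omega>) \<le> \<rho> ^ n * (S \<omega> + S' \<omega>)"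
    using S(3) S'(3)
  proof eventually_elim
    case (elim \<omega>)
    have "0 \<le> \<rho> ^ n * S \<omega>" "0 \<le> \<rho> ^ n * S' \<omega>" for n using S(2) S'(2) \<rho> by auto
    then show ?case using elim by (auto simp: distrib_left intro: add_increasing add_increasing2)
  qed
  then show ?thesis using \<rho> S S' by (intro exI[of _ \<rho>] exI[of _ "\<lambda>\<omega>. S \<omega> + S' \<omega>"]) auto
qed

section \<open>The invariant family\<close>

context markov_environment
begin

section \<open>Translation between operators on carriers and kernels on the whole space\<close>

lemma markov_op_iter_eq_kern:
  fixes g :: "'x \<Rightarrow> real"
  assumes R: "\<And>\<omega> x. \<omega> \<in> space (path_space MY) \<Longrightarrow> x \<in> X \<omega> \<Longrightarrow> Q \<omega> x = R \<omega> x"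
    and w: "\<omega> \<in> space (path_space MY)" "carried X Q \<omega>" and x: "x \<in> X \<omega>"
    and g: "g \<in> borel_measurable MX" and B: "\<And>x. x \<in> space MX \<Longrightarrow> \<bar>g x\<bar> \<le> B"
    and h: "\<And>y. y \<in> X (lshift (int n) \<omega>) \<Longrightarrow> h y = g y"
  shows "markov_op_iter X R n \<omega> h x = (LINT y|kern n \<omega> x. g y)"
  using w x h
proof (induction n arbitrary: \<omega> x)
  case 0
  then show ?case using integral_return[of x MX g] g X_space by simp
next
  case (Suc n)
  have w: "lshift 1 \<omega> \<in> space (path_space MY)" "carried X Q (lshift 1 \<omega>)"
    using Suc.prems lshift_space carried_lshift by auto
  have q: "Q \<omega> x \<in> space (prob_algebra MX)" using measurable_space[OF Q_section] Suc.prems X_space by blast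
  have full: "measure (Q \<omega> x) (X (lshift 1 \<omega>)) = 1"
    using Suc.prems(2,3) unfolding carried_def by (elim allE[of _ "0::int"]) simp
  define G where "G y = (LINT z|kern n (lshift 1 \<omega>) y. g z)" for y
  have G: "G \<in> borel_measurable MX" unfolding G_def using kern_integral[OF w(1) g B] by auto
  have IH: "markov_op_iter X R n (lshift 1 \<omega>) h y = G y" if "y \<in> X (lshift 1 \<omega>)" for y
    unfolding G_def using Suc.IH[OF w that] Suc.prems(4) by (simp add: add.commute)
  have s: "sets (Q \<omega> x) = sets MX" using q by (simp add: space_prob_algebra)
  have "markov_op_iter X R (Suc n) \<omega> h x = (LINT y|Q \<omega> x. indicator (X (lshift 1 \<omega>)) y * G y)"
    unfolding markov_op_iter.simps markov_op_def set_lebesgue_integral_def R[OF Suc.prems(1,3)]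
    by (intro Bochner_Integration.integral_cong refl) (auto simp: indicator_def IH)
  also have "\<dots> = (LINT y|Q \<omega> x. G y)"
    using prob_algebra_AE_full[OF q X_sets[OF w(1)] full] G X_sets[OF w(1)] measurable_cong_sets[OF s refl]
    by (intro integral_cong_AE) (auto elim!: AE_mp)
  also have "\<dots> = (LINT z|kern (Suc n) \<omega> x. g z)"
    using integral_bind_bounded[OF q kern_section[OF w(1)] g B] by (simp add: G_def)
  finally show ?case .
qed

lemma minorized_of_doeblin_bound:
  assumes R: "\<And>\<omega> x. \<omega> \<in> space (path_space MY) \<Longrightarrow> x \<in> X \<omega> \<Longrightarrow> Q \<omega> x = R \<omega> x"
    and w: "\<omega> \<in> space (path_space MY)" "carried X Q \<omega>"
    and bd: "doeblin_bound MX X R \<omega> n \<gamma> m" and m: "m \<in> space (prob_algebra MX)" "measure m (X \<omega>) = 1"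
    and le: "n \<le> L" "d \<le> \<gamma>"
  shows "minorized MX X Q L d \<omega>"
  unfolding minorized_def
proof (intro exI[of _ n] conjI bexI[of _ m] ballI impI)
  fix x \<Gamma> assume x: "x \<in> X (lshift (- int n) \<omega>)" and \<Gamma>: "\<Gamma> \<in> sets MX" "\<Gamma> \<subseteq> X \<omega>"
  have w': "lshift (- int n) \<omega> \<in> space (path_space MY)" "carried X Q (lshift (- int n) \<omega>)"
    using w lshift_space carried_lshift by auto
  have k: "kern n (lshift (- int n) \<omega>) x \<in> space (prob_algebra MX)" using kern_space w' x X_space by blast
  have "d * measure m \<Gamma> \<le> \<gamma> * measure m \<Gamma>" using le by (intro mult_right_mono) auto
  also have "\<dots> \<le> nstep_prob X R n (lshift (- int n) \<omega>) x \<Gamma>"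
    using bd x \<Gamma> unfolding doeblin_bound_def sets_restrict_space by blast
  also have "\<dots> = (LINT y|kern n (lshift (- int n) \<omega>) x. indicator \<Gamma> y)"
    unfolding nstep_prob_def using \<Gamma>
    by (intro markov_op_iter_eq_kern[OF R w' x, where B=1]) (auto simp: indicator_def)
  also have "\<dots> = measure (kern n (lshift (- int n) \<omega>) x) \<Gamma>"
    using k \<Gamma> sets.Int_space_eq2[of \<Gamma> "kern n (lshift (- int n) \<omega>) x"] by (simp add: space_prob_algebra)
  finally show "d * measure m \<Gamma> \<le> measure (kern n (lshift (- int n) \<omega>) x) \<Gamma>" .
qed (use m le in auto)

lemma op_dist_le_decay:
  assumes R: "\<And>\<omega> x. \<omega> \<in> space (path_space MY) \<Longrightarrow> x \<in> X \<omega> \<Longrightarrow> Q \<omega> x = R \<omega> x"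
    and w: "\<omega> \<in> space (path_space MY)" "carried X Q \<omega>" and d: "0 \<le> d"
    and min: "\<And>k. lshift k \<omega> \<in> A \<Longrightarrow> minorized MX X Q L d (lshift k \<omega>)"
    and \<alpha>: "\<alpha> \<in> space (prob_algebra MX)" "measure \<alpha> (X \<omega>) = 1"
  shows "op_dist MX X R n \<omega> (\<alpha> \<bind> kern n \<omega>) \<le> ereal (2 * decay A L d n \<omega>)"
  unfolding op_dist_def
proof (intro SUP_least)
  fix g :: "'x \<Rightarrow> real" and x assume g: "g \<in> {g \<in> borel_measurable (restrict_space MX (X (lshift (int n) \<omega>))). \<forall>y\<in>X (lshift (int n) \<omega>). \<bar>g y\<bar> \<le> 1}"
    and x: "x \<in> X \<omega>"
  let ?X = "X (lshift (int n) \<omega>)"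
  have X: "?X \<in> sets MX" using X_sets lshift_space w by blast
  \<comment> \<open>The test function g is measurable on the carrier only; extension by 0 makes it
    measurable on the whole state space without changing its bound.\<close>
  define f where "f y = (if y \<in> ?X then g y else 0)" for y
  have f: "f \<in> borel_measurable MX"
    unfolding f_def using g X by (subst measurable_restrict_space_iff[symmetric]) auto
  have B: "\<bar>f y\<bar> \<le> 1" for y using g by (auto simp: f_def)
  have xm: "x \<in> space MX" using X_space w x by blast
  have "markov_op_iter X R n \<omega> g x = (LINT y|kern n \<omega> x. f y)"
    by (rule markov_op_iter_eq_kern[OF R w x f, where B=1]) (use B in \<open>auto simp: f_def\<close>)
  \<comment> \<open>Starting at x is starting from the point mass at x, so the operator norm
    compares two initial laws under the same n-step kernel.\<close>
  also have "kern n \<omega> x = return MX x \<bind> kern n \<omega>"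
    using bind_return[OF measurable_prob_algebraD[OF kern_section[OF w(1)]] xm] by simp
  finally have 1: "markov_op_iter X R n \<omega> g x = (LINT y|(return MX x \<bind> kern n \<omega>). f y)" .
  have 2: "(LINT y:?X|(\<alpha> \<bind> kern n \<omega>). g y) = (LINT y|(\<alpha> \<bind> kern n \<omega>). f y)"
    unfolding set_lebesgue_integral_def by (intro Bochner_Integration.integral_cong) (auto simp: f_def)
  have "return MX x \<in> space (prob_algebra MX)" "measure (return MX x) (X \<omega>) = 1"
    using xm x X_sets[OF w(1)] by (auto simp: space_prob_algebra prob_space_return measure_return)
  from bind_kern_decay[OF w d min f B this \<alpha>]
  show "ereal \<bar>markov_op_iter X R n \<omega> g x - (LINT y:?X|(\<alpha> \<bind> kern n \<omega>). g y)\<bar> \<le> ereal (2 * decay A L d n \<omega>)"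
    unfolding 1 2 by simp
qed

text \<open>R and Q agree on \<open>X \<omega>\<close>, whose complement is null for \<alpha>. Hence
  neither the restriction nor the values chosen for the extension affect the composite.\<close>

lemma dual_markov_eq_bind:
  assumes R: "\<And>\<omega> x. \<omega> \<in> space (path_space MY) \<Longrightarrow> x \<in> X \<omega> \<Longrightarrow> Q \<omega> x = R \<omega> x"
    and w: "\<omega> \<in> space (path_space MY)" and \<alpha>: "\<alpha> \<in> space (prob_algebra MX)" "measure \<alpha> (X \<omega>) = 1"
  shows "dual_markov X R \<omega> \<alpha> = \<alpha> \<bind> Q \<omega>"
proof -
  have s: "sets \<alpha> = sets MX" "space \<alpha> = space MX" using \<alpha> sets_eq_imp_space_eq[of \<alpha> MX] by (auto simp: space_prob_algebra)
  have X: "X \<omega> \<in> sets \<alpha>" using X_sets[OF w] s by simp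
  \<comment> \<open>Nonemptiness excludes the default value that \<open>bind\<close> takes over an
    empty space.\<close>
  have ne: "X \<omega> \<noteq> {}" using \<alpha>(2) by auto
  have sr: "space (restrict_space \<alpha> (X \<omega>)) = X \<omega>" using X sets.sets_into_space by (auto simp: space_restrict_space)
  have Qm: "Q \<omega> \<in> \<alpha> \<rightarrow>\<^sub>M subprob_algebra MX"
    using measurable_prob_algebraD[OF Q_section[OF w]] s by (simp cong: measurable_cong_sets)
  then have Qr: "Q \<omega> \<in> restrict_space \<alpha> (X \<omega>) \<rightarrow>\<^sub>M subprob_algebra MX" by (rule measurable_restrict_space1)
  have "dual_markov X R \<omega> \<alpha> = restrict_space \<alpha> (X \<omega>) \<bind> Q \<omega>"
    unfolding dual_markov_def using R[OF w] sr by (intro bind_cong) auto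
  also have "\<dots> = \<alpha> \<bind> Q \<omega>"
  proof (rule measure_eqI)
    have 1: "sets (restrict_space \<alpha> (X \<omega>) \<bind> Q \<omega>) = sets MX" using sets_bind_measurable[OF Qr] sr ne by simp
    also have "\<dots> = sets (\<alpha> \<bind> Q \<omega>)" using sets_bind'[OF \<alpha>(1) Q_section[OF w]] by simp
    finally show "sets (restrict_space \<alpha> (X \<omega>) \<bind> Q \<omega>) = sets (\<alpha> \<bind> Q \<omega>)" .
    fix A assume "A \<in> sets (restrict_space \<alpha> (X \<omega>) \<bind> Q \<omega>)"
    then have A: "A \<in> sets MX" using 1 by simp
    have "emeasure (restrict_space \<alpha> (X \<omega>) \<bind> Q \<omega>) A = (\<integral>\<^sup>+x. emeasure (Q \<omega> x) A * indicator (X \<omega>) x \<partial>\<alpha>)"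
      using emeasure_bind[OF _ Qr A] sr ne X by (simp add: nn_integral_restrict_space)
    also have "\<dots> = (\<integral>\<^sup>+x. emeasure (Q \<omega> x) A \<partial>\<alpha>)"
      using prob_algebra_AE_full[OF \<alpha>(1) X_sets[OF w] \<alpha>(2)] by (intro nn_integral_cong_AE) (auto elim!: AE_mp)
    also have "\<dots> = emeasure (\<alpha> \<bind> Q \<omega>) A" using emeasure_bind_prob_algebra[OF \<alpha>(1) Q_section[OF w] A] by simp
    finally show "emeasure (restrict_space \<alpha> (X \<omega>) \<bind> Q \<omega>) A = emeasure (\<alpha> \<bind> Q \<omega>) A" .
  qed
  finally show ?thesis .
qed

section \<open>Uniqueness and existence by pullback from the past\<close>

text \<open>Both values at \<omega> are images, under one and the same n-step kernel, of laws at
  time -n. Their distance is bounded by the contraction over that stretch, for every n.\<close>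

lemma invariant_family_unique:
  assumes w: "\<omega> \<in> space (path_space MY)" "carried X Q \<omega>" and d: "0 \<le> d"
    and min: "\<And>k. lshift k \<omega> \<in> A \<Longrightarrow> minorized MX X Q L d (lshift k \<omega>)"
    and lim: "(\<lambda>n. decay A L d n (lshift (- int n) \<omega>)) \<longlonglongrightarrow> 0"
    and \<mu>: "\<And>k. \<mu> (lshift k \<omega>) \<in> space (prob_algebra MX)" "\<And>k. measure (\<mu> (lshift k \<omega>)) (X (lshift k \<omega>)) = 1"
      "\<And>k. \<mu> (lshift k \<omega>) \<bind> Q (lshift k \<omega>) = \<mu> (lshift (k + 1) \<omega>)"
    and \<nu>: "\<And>k. \<nu> (lshift k \<omega>) \<in> space (prob_algebra MX)" "\<And>k. measure (\<nu> (lshift k \<omega>)) (X (lshift k \<omega>)) = 1"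
      "\<And>k. \<nu> (lshift k \<omega>) \<bind> Q (lshift k \<omega>) = \<nu> (lshift (k + 1) \<omega>)"
  shows "\<nu> \<omega> = \<mu> \<omega>"
proof (rule measure_eqI)
  have s: "\<mu> \<omega> \<in> space (prob_algebra MX)" "\<nu> \<omega> \<in> space (prob_algebra MX)"
    using \<mu>(1)[of 0] \<nu>(1)[of 0] by auto
  then show "sets (\<nu> \<omega>) = sets (\<mu> \<omega>)" by (simp add: space_prob_algebra)
  fix B assume "B \<in> sets (\<nu> \<omega>)"
  then have B: "B \<in> sets MX" using s by (simp add: space_prob_algebra)
  have "\<bar>measure (\<nu> \<omega>) B - measure (\<mu> \<omega>) B\<bar> \<le> 2 * decay A L d n (lshift (- int n) \<omega>)" for n
  proof -
    define \<omega>' where "\<omega>' = lshift (- int n) \<omega>"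
    have w': "\<omega>' \<in> space (path_space MY)" "carried X Q \<omega>'"
      using w lshift_space carried_lshift by (auto simp: \<omega>'_def)
    have it: "\<mu> \<omega>' \<bind> kern n \<omega>' = \<mu> \<omega>" "\<nu> \<omega>' \<bind> kern n \<omega>' = \<nu> \<omega>"
      using invariant_iterate[OF w(1) \<mu>(1,3), of "- int n" n] invariant_iterate[OF w(1) \<nu>(1,3), of "- int n" n]
      by (auto simp: \<omega>'_def)
    have "\<bar>(LINT x|(\<nu> \<omega>' \<bind> kern n \<omega>'). indicator B x) - (LINT x|(\<mu> \<omega>' \<bind> kern n \<omega>'). indicator B x)\<bar>
        \<le> 2 * decay A L d n \<omega>'"
      using B \<mu>(1,2) \<nu>(1,2) min by (intro bind_kern_decay[OF w' d]) (auto simp: \<omega>'_def indicator_def)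
    then show ?thesis
      unfolding it \<omega>'_def[symmetric] using s B sets.Int_space_eq2[of B "\<mu> \<omega>"] sets.Int_space_eq2[of B "\<nu> \<omega>"]
      by (simp add: space_prob_algebra)
  qed
  then have "\<bar>measure (\<nu> \<omega>) B - measure (\<mu> \<omega>) B\<bar> \<le> 0"
    using LIMSEQ_le_const[OF tendsto_mult_right_zero[OF lim, of 2]] by blast
  then have "measure (\<nu> \<omega>) B = measure (\<mu> \<omega>) B" by simp
  then show "emeasure (\<nu> \<omega>) B = emeasure (\<mu> \<omega>) B"
    using s by (simp add: space_prob_algebra prob_space.finite_measure finite_measure.emeasure_eq_measure)
qed

text \<open>Starting from m at time -(n + l) amounts to starting at time -n from the law that m has
  become after l steps. Both pullbacks end with the same n steps, so the bound is independent of
  l.\<close>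

lemma pullback_cauchy:
  assumes w: "\<omega> \<in> space (path_space MY)" "carried X Q \<omega>" and d: "0 \<le> d"
    and min: "\<And>k. lshift k \<omega> \<in> A \<Longrightarrow> minorized MX X Q L d (lshift k \<omega>)"
    and m: "\<And>\<omega>. \<omega> \<in> space (path_space MY) \<Longrightarrow> m \<omega> \<in> space (prob_algebra MX)"
      "\<And>\<omega>. \<omega> \<in> space (path_space MY) \<Longrightarrow> measure (m \<omega>) (X \<omega>) = 1"
    and B: "B \<in> sets MX"
  shows "\<bar>measure (m (lshift (- int (n + l)) \<omega>) \<bind> kern (n + l) (lshift (- int (n + l)) \<omega>)) B
      - measure (m (lshift (- int n) \<omega>) \<bind> kern n (lshift (- int n) \<omega>)) B\<bar>
    \<le> 2 * decay A L d n (lshift (- int n) \<omega>)"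
proof -
  define \<omega>' where "\<omega>' = lshift (- int n) \<omega>"
  define \<omega>'' where "\<omega>'' = lshift (- int (n + l)) \<omega>"
  have w': "\<omega>' \<in> space (path_space MY)" "carried X Q \<omega>'" "\<omega>'' \<in> space (path_space MY)" "carried X Q \<omega>''"
    using w lshift_space carried_lshift by (auto simp: \<omega>'_def \<omega>''_def)
  have sh: "lshift (int l) \<omega>'' = \<omega>'" by (simp add: \<omega>'_def \<omega>''_def)
  have eq: "m \<omega>'' \<bind> kern (n + l) \<omega>'' = m \<omega>'' \<bind> kern l \<omega>'' \<bind> kern n \<omega>'"
    unfolding bind_assoc'[OF m(1)[OF w'(3)] kern_section[OF w'(3)] kern_section[OF w'(1)]]
    using kern_add[OF w'(3), of _ l n] sh by (intro bind_cong'[OF m(1)[OF w'(3)]]) (simp add: add.commute)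
  have \<beta>: "m \<omega>'' \<bind> kern l \<omega>'' \<in> space (prob_algebra MX)"
    by (rule bind_space[OF m(1)[OF w'(3)] kern_section[OF w'(3)]])
  have \<beta>1: "measure (m \<omega>'' \<bind> kern l \<omega>'') (X \<omega>') = 1"
    by (rule bind_full[OF m(1)[OF w'(3)] X_sets[OF w'(3)] m(2)[OF w'(3)] kern_section[OF w'(3)] X_sets[OF w'(1)]])
       (use kern_full[OF w'(3,4), of _ l] sh in simp)
  have "\<bar>(LINT x|(m \<omega>'' \<bind> kern l \<omega>'' \<bind> kern n \<omega>'). indicator B x) - (LINT x|(m \<omega>' \<bind> kern n \<omega>'). indicator B x)\<bar>
      \<le> 2 * decay A L d n \<omega>'"
    using B min by (intro bind_kern_decay[OF w'(1,2) d _ _ _ \<beta> \<beta>1 m(1)[OF w'(1)] m(2)[OF w'(1)]]) (auto simp: \<omega>'_def indicator_def)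
  then show ?thesis
    unfolding \<omega>'_def[symmetric] \<omega>''_def[symmetric] eq
    using B bind_space[OF \<beta> kern_section[OF w'(1)], of n] bind_space[OF m(1)[OF w'(1)] kern_section[OF w'(1)], of n]
      sets.Int_space_eq2[of B "m \<omega>'' \<bind> kern l \<omega>'' \<bind> kern n \<omega>'"] sets.Int_space_eq2[of B "m \<omega>' \<bind> kern n \<omega>'"]
    by (simp add: space_prob_algebra)
qed

text \<open>The pullbacks satisfy the invariance relation exactly, up to an index shift. The limit
  inherits it because the convergence is uniform over sets and so survives one application of the
  kernel.\<close>

lemma invariant_family_exists:
  assumes m: "random_prob_family MY MX X m" and d: "0 \<le> d"
    and G: "G \<in> sets (path_space MY)" and shift: "\<And>\<omega> k. \<omega> \<in> G \<Longrightarrow> lshift k \<omega> \<in> G"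
    and car: "\<And>\<omega>. \<omega> \<in> G \<Longrightarrow> carried X Q \<omega>"
    and min: "\<And>\<omega>. \<omega> \<in> G \<Longrightarrow> \<omega> \<in> A \<Longrightarrow> minorized MX X Q L d \<omega>"
    and lim: "\<And>\<omega>. \<omega> \<in> G \<Longrightarrow> (\<lambda>n. decay A L d n (lshift (- int n) \<omega>)) \<longlonglongrightarrow> 0"
  shows "\<exists>\<mu>. random_prob_family MY MX X \<mu> \<and> (\<forall>\<omega>\<in>G. \<mu> \<omega> \<bind> Q \<omega> = \<mu> (lshift 1 \<omega>))"
proof -
  have mm: "m \<in> path_space MY \<rightarrow>\<^sub>M prob_algebra MX" using m by (simp add: random_prob_family_def)
  have m1: "m \<omega> \<in> space (prob_algebra MX)" if "\<omega> \<in> space (path_space MY)" for \<omega> using measurable_space[OF mm that] .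
  have m2: "measure (m \<omega>) (X \<omega>) = 1" if "\<omega> \<in> space (path_space MY)" for \<omega>
    using m that by (simp add: random_prob_family_def)
  have Gs: "\<omega> \<in> space (path_space MY)" if "\<omega> \<in> G" for \<omega> using sets.sets_into_space[OF G] that by blast
  define \<nu> where "\<nu> n \<omega> = m (lshift (- int n) \<omega>) \<bind> kern n (lshift (- int n) \<omega>)" for n \<omega>
  define v where "v n \<omega> = 2 * decay A L d n (lshift (- int n) \<omega>)" for n \<omega>
  have \<nu>m: "\<nu> n \<in> path_space MY \<rightarrow>\<^sub>M prob_algebra MX" for n
  proof -
    have "(\<lambda>p. (\<lambda>(\<omega>, x). kern n \<omega> x) (lshift (- int n) (fst p), snd p)) \<in> path_space MY \<Otimes>\<^sub>M MX \<rightarrow>\<^sub>M prob_algebra MX"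
      by (rule measurable_compose[OF _ kern_measurable]) measurable
    then show ?thesis unfolding \<nu>_def[abs_def]
      by (intro measurable_bind_prob_space2[where N=MX] measurable_compose[OF lshift_measurable mm])
        (simp add: case_prod_beta')
  qed
  have \<nu>1: "\<nu> n \<omega> \<in> space (prob_algebra MX)" if "\<omega> \<in> space (path_space MY)" for n \<omega>
    using measurable_space[OF \<nu>m that] .
  have v0: "(\<lambda>n. v n \<omega>) \<longlonglongrightarrow> 0" if "\<omega> \<in> G" for \<omega>
    unfolding v_def using tendsto_mult_right_zero[OF lim[OF that]] .
  have "\<exists>\<mu>. \<mu> \<in> space (prob_algebra MX) \<and> (\<forall>B\<in>sets MX. \<forall>n. \<bar>measure \<mu> B - measure (\<nu> n \<omega>) B\<bar> \<le> v n \<omega>)"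
    if w: "\<omega> \<in> G" for \<omega>
  proof -
    have "\<exists>\<mu>\<in>space (prob_algebra MX). \<forall>B\<in>sets MX. \<forall>n. \<bar>measure \<mu> B - measure (\<nu> n \<omega>) B\<bar> \<le> v n \<omega>"
    proof (rule total_variation_limit[OF \<nu>1[OF Gs[OF w]] _ v0[OF w]])
      fix n l B assume "B \<in> sets MX"
      then show "\<bar>measure (\<nu> (n + l) \<omega>) B - measure (\<nu> n \<omega>) B\<bar> \<le> v n \<omega>"
        unfolding \<nu>_def v_def using pullback_cauchy[OF Gs[OF w] car[OF w] d min[OF shift[OF w]] m1 m2] by blast
    qed
    then show ?thesis by blast
  qed
  then have "\<forall>\<omega>\<in>G. \<exists>\<mu>. \<mu> \<in> space (prob_algebra MX) \<and> (\<forall>B\<in>sets MX. \<forall>n. \<bar>measure \<mu> B - measure (\<nu> n \<omega>) B\<bar> \<le> v n \<omega>)"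
    by blast
  \<comment> \<open>The limits are chosen separately for each \<omega>, without any measurability;
    this is recovered below, since on G the chosen measures are setwise limits of measurable
    families.\<close>
  from bchoice[OF this] obtain \<mu>0 where \<mu>0: "\<And>\<omega>. \<omega> \<in> G \<Longrightarrow> \<mu>0 \<omega> \<in> space (prob_algebra MX)"
    "\<And>\<omega> B n. \<omega> \<in> G \<Longrightarrow> B \<in> sets MX \<Longrightarrow> \<bar>measure (\<mu>0 \<omega>) B - measure (\<nu> n \<omega>) B\<bar> \<le> v n \<omega>"
    by blast
  \<comment> \<open>\<open>random_prob_family\<close> asks for a probability measure with full mass
    on the carrier at every \<omega>, so m is used off G.\<close>
  define \<mu> where "\<mu> \<omega> = (if \<omega> \<in> G then \<mu>0 \<omega> else m \<omega>)" for \<omega>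
  have \<mu>1: "\<mu> \<omega> \<in> space (prob_algebra MX)" if "\<omega> \<in> space (path_space MY)" for \<omega>
    using \<mu>0(1) m1[OF that] by (auto simp: \<mu>_def)
  have \<mu>v: "\<bar>measure (\<mu> \<omega>) B - measure (\<nu> n \<omega>) B\<bar> \<le> v n \<omega>" if "\<omega> \<in> G" "B \<in> sets MX" for \<omega> B n
    using \<mu>0(2)[OF that] that by (simp add: \<mu>_def)
  have conv: "(\<lambda>n. measure (\<nu> n \<omega>) B) \<longlonglongrightarrow> measure (\<mu> \<omega>) B" if "\<omega> \<in> G" "B \<in> sets MX" for \<omega> B
  proof -
    have "(\<lambda>n. measure (\<nu> n \<omega>) B - measure (\<mu> \<omega>) B) \<longlonglongrightarrow> 0"
      by (rule Lim_null_comparison[OF _ v0[OF that(1)]])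
         (use \<mu>v[OF that] in \<open>auto simp: abs_minus_commute\<close>)
    then show ?thesis by (simp add: LIM_zero_iff)
  qed
  have "\<mu> \<in> path_space MY \<rightarrow>\<^sub>M prob_algebra MX"
  proof (rule measurable_prob_algebraI)
    show "prob_space (\<mu> \<omega>)" if "\<omega> \<in> space (path_space MY)" for \<omega> using \<mu>1[OF that] by (simp add: space_prob_algebra)
    show "\<mu> \<in> path_space MY \<rightarrow>\<^sub>M subprob_algebra MX"
    proof (rule measurable_subprob_algebra)
      fix \<omega> assume "\<omega> \<in> space (path_space MY)"
      from \<mu>1[OF this] show "subprob_space (\<mu> \<omega>)" "sets (\<mu> \<omega>) = sets MX"
        by (auto simp: space_prob_algebra prob_space_imp_subprob_space)
    next
      fix B assume B: "B \<in> sets MX"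
      have meas: "(\<lambda>\<omega>. measure (K \<omega>) B) \<in> borel_measurable (path_space MY)"
        if "K \<in> path_space MY \<rightarrow>\<^sub>M prob_algebra MX" for K
        using measurable_compose[OF that measurable_measure_prob_algebra[OF B]] .
      have "(\<lambda>\<omega>. measure (\<mu> \<omega>) B) \<in> borel_measurable (path_space MY)"
      proof (rule borel_measurable_LIMSEQ_real)
        fix n show "(\<lambda>\<omega>. if \<omega> \<in> G then measure (\<nu> n \<omega>) B else measure (m \<omega>) B) \<in> borel_measurable (path_space MY)"
          using meas[OF \<nu>m] meas[OF mm] G by (intro measurable_If_set) auto
      next
        fix \<omega> assume "\<omega> \<in> space (path_space MY)"
        show "(\<lambda>n. if \<omega> \<in> G then measure (\<nu> n \<omega>) B else measure (m \<omega>) B) \<longlonglongrightarrow> measure (\<mu> \<omega>) B"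
          using conv[OF _ B] by (auto simp: \<mu>_def)
      qed
      then have "(\<lambda>\<omega>. ennreal (measure (\<mu> \<omega>) B)) \<in> borel_measurable (path_space MY)" by measurable
      moreover have "emeasure (\<mu> \<omega>) B = ennreal (measure (\<mu> \<omega>) B)" if "\<omega> \<in> space (path_space MY)" for \<omega>
        using \<mu>1[OF that] by (simp add: space_prob_algebra prob_space.finite_measure finite_measure.emeasure_eq_measure)
      ultimately show "(\<lambda>\<omega>. emeasure (\<mu> \<omega>) B) \<in> borel_measurable (path_space MY)"
        by (simp cong: measurable_cong)
    qed
  qed
  moreover have "measure (\<mu> \<omega>) (X \<omega>) = 1" if w: "\<omega> \<in> space (path_space MY)" for \<omega>
  proof (cases "\<omega> \<in> G")
    case True
    have "measure (\<nu> n \<omega>) (X \<omega>) = 1" for n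
    proof -
      have w': "lshift (- int n) \<omega> \<in> space (path_space MY)" "carried X Q (lshift (- int n) \<omega>)"
        using w lshift_space car[OF shift[OF True]] by auto
      show ?thesis unfolding \<nu>_def
        by (rule bind_full[OF m1[OF w'(1)] X_sets[OF w'(1)] m2[OF w'(1)] kern_section[OF w'(1)] X_sets[OF w]])
           (use kern_full[OF w', of _ n] in simp)
    qed
    then show ?thesis using LIMSEQ_unique[OF conv[OF True X_sets[OF w]], of 1] by simp
  next
    case False
    then show ?thesis using m2[OF w] by (simp add: \<mu>_def)
  qed
  moreover have "\<mu> \<omega> \<bind> Q \<omega> = \<mu> (lshift 1 \<omega>)" if w: "\<omega> \<in> G" for \<omega>
  proof (rule measure_eqI)
    have ws: "\<omega> \<in> space (path_space MY)" "lshift 1 \<omega> \<in> space (path_space MY)" "lshift 1 \<omega> \<in> G"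
      using Gs shift w by auto
    have p: "\<mu> \<omega> \<bind> Q \<omega> \<in> space (prob_algebra MX)" "\<mu> (lshift 1 \<omega>) \<in> space (prob_algebra MX)"
      using bind_space[OF \<mu>1[OF ws(1)] Q_section[OF ws(1)]] \<mu>1[OF ws(2)] by auto
    then show "sets (\<mu> \<omega> \<bind> Q \<omega>) = sets (\<mu> (lshift 1 \<omega>))" by (simp add: space_prob_algebra)
    fix B assume "B \<in> sets (\<mu> \<omega> \<bind> Q \<omega>)"
    then have B: "B \<in> sets MX" using p by (simp add: space_prob_algebra)
    have bnd: "measure (\<alpha> \<bind> Q \<omega>) B = (LINT x|\<alpha>. measure (Q \<omega> x) B)" if a: "\<alpha> \<in> space (prob_algebra MX)" for \<alpha>
    proof -
      have meas: "measure \<beta> B = (LINT x|\<beta>. indicator B x)" if "\<beta> \<in> space (prob_algebra MX)" for \<beta>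
        using that B sets.Int_space_eq2[of B \<beta>] by (simp add: space_prob_algebra)
      have sp: "space \<alpha> = space MX" using a sets_eq_imp_space_eq by (auto simp: space_prob_algebra)
      have "measure (\<alpha> \<bind> Q \<omega>) B = (LINT x|(\<alpha> \<bind> Q \<omega>). indicator B x)"
        by (rule meas[OF bind_space[OF a Q_section[OF ws(1)]]])
      also have "\<dots> = (LINT x|\<alpha>. LINT y|Q \<omega> x. indicator B y)"
        by (rule integral_bind_bounded[OF a Q_section[OF ws(1)], where B=1]) (use B in \<open>auto simp: indicator_def\<close>)
      also have "\<dots> = (LINT x|\<alpha>. measure (Q \<omega> x) B)"
        using meas measurable_space[OF Q_section[OF ws(1)]] sp by (intro Bochner_Integration.integral_cong) auto
      finally show ?thesis .
    qed
    \<comment> \<open>Index \<open>Suc n\<close> at \<open>lshift 1 \<omega>\<close> and index n at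
      \<omega> start from the same past environment; they differ by the final step alone.\<close>
    have step: "\<nu> (Suc n) (lshift 1 \<omega>) = \<nu> n \<omega> \<bind> Q \<omega>" for n
    proof -
      define \<omega>' where "\<omega>' = lshift (- int n) \<omega>"
      have w': "\<omega>' \<in> space (path_space MY)" using ws lshift_space by (auto simp: \<omega>'_def)
      have sh: "lshift (int n) \<omega>' = \<omega>" "lshift (- int (Suc n)) (lshift 1 \<omega>) = \<omega>'" by (simp_all add: \<omega>'_def)
      have one: "kern 1 \<omega> x = Q \<omega> x" if "x \<in> space MX" for x
        using that measurable_space[OF Q_section[OF ws(1)] that] by (simp add: space_prob_algebra bind_return'')
      have "kern (Suc n) \<omega>' x = kern n \<omega>' x \<bind> Q \<omega>" if "x \<in> space MX" for x
      proof -
        have "kern (n + 1) \<omega>' x = kern n \<omega>' x \<bind> kern 1 \<omega>" using kern_add[OF w' that, of n 1] sh by simp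
        also have "\<dots> = kern n \<omega>' x \<bind> Q \<omega>" by (rule bind_cong'[OF kern_space[OF w' that] one])
        finally show ?thesis by simp
      qed
      then have "\<nu> (Suc n) (lshift 1 \<omega>) = m \<omega>' \<bind> (\<lambda>x. kern n \<omega>' x \<bind> Q \<omega>)"
        unfolding \<nu>_def sh(2) by (intro bind_cong'[OF m1[OF w']])
      also have "\<dots> = \<nu> n \<omega> \<bind> Q \<omega>"
        unfolding \<nu>_def \<omega>'_def[symmetric] using bind_assoc'[OF m1[OF w'] kern_section[OF w'] Q_section[OF ws(1)]] by simp
      finally show ?thesis .
    qed
    \<comment> \<open>After one step the mass of B is the integral of
      \<open>measure (Q \<omega> x) B\<close>, a function of x with values in [0,1], so the setwise
      rate \<open>v n \<omega>\<close> carries over unchanged.\<close>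
    have "(\<lambda>n. measure (\<nu> n \<omega> \<bind> Q \<omega>) B - measure (\<mu> \<omega> \<bind> Q \<omega>) B) \<longlonglongrightarrow> 0"
    proof (rule Lim_null_comparison[OF _ v0[OF w]], rule always_eventually, rule allI)
      fix n
      have "\<bar>(LINT x|\<nu> n \<omega>. measure (Q \<omega> x) B) - (LINT x|\<mu> \<omega>. measure (Q \<omega> x) B)\<bar> \<le> v n \<omega>"
      proof (rule integral_diff_le_of_measure_diff_le[OF \<nu>1[OF ws(1)] \<mu>1[OF ws(1)]])
        show "(\<lambda>x. measure (Q \<omega> x) B) \<in> borel_measurable MX"
          using measurable_compose[OF Q_section[OF ws(1)] measurable_measure_prob_algebra[OF B]] .
        show "0 \<le> measure (Q \<omega> x) B \<and> measure (Q \<omega> x) B \<le> 1" if "x \<in> space MX" for x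
          using measurable_space[OF Q_section[OF ws(1)] that] by (auto simp: space_prob_algebra prob_space.prob_le_1)
      qed (use \<mu>v[OF w] in \<open>auto simp: abs_minus_commute\<close>)
      then show "norm (measure (\<nu> n \<omega> \<bind> Q \<omega>) B - measure (\<mu> \<omega> \<bind> Q \<omega>) B) \<le> v n \<omega>"
        using bnd[OF \<nu>1[OF ws(1)]] bnd[OF \<mu>1[OF ws(1)]] by simp
    qed
    then have "(\<lambda>n. measure (\<nu> (Suc n) (lshift 1 \<omega>)) B) \<longlonglongrightarrow> measure (\<mu> \<omega> \<bind> Q \<omega>) B"
      unfolding step by (simp add: LIM_zero_iff)
    moreover have "(\<lambda>n. measure (\<nu> (Suc n) (lshift 1 \<omega>)) B) \<longlonglongrightarrow> measure (\<mu> (lshift 1 \<omega>)) B"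
      using LIMSEQ_Suc[OF conv[OF ws(3) B]] .
    ultimately have "measure (\<mu> \<omega> \<bind> Q \<omega>) B = measure (\<mu> (lshift 1 \<omega>)) B" by (rule LIMSEQ_unique)
    then show "emeasure (\<mu> \<omega> \<bind> Q \<omega>) B = emeasure (\<mu> (lshift 1 \<omega>)) B"
      using p by (simp add: space_prob_algebra prob_space.finite_measure finite_measure.emeasure_eq_measure)
  qed
  ultimately show ?thesis by (intro exI[of _ \<mu>]) (auto simp: random_prob_family_def)
qed

end

section \<open>Good environments and the choice of a Doeblin level\<close>

lemma extended_kernel_measurable:
  assumes X: "Sigma (space (path_space MY)) X \<in> sets (path_space MY \<Otimes>\<^sub>M MX)"
    and R: "(\<lambda>(\<omega>, x). R \<omega> x) \<in>
       restrict_space (path_space MY \<Otimes>\<^sub>M MX) (Sigma (space (path_space MY)) X) \<rightarrow>\<^sub>M prob_algebra MX"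
    and m: "m \<in> path_space MY \<rightarrow>\<^sub>M prob_algebra MX"
  shows "(\<lambda>(\<omega>, x). if x \<in> X \<omega> then R \<omega> x else m \<omega>) \<in> path_space MY \<Otimes>\<^sub>M MX \<rightarrow>\<^sub>M prob_algebra MX"
proof -
  let ?M = "path_space MY \<Otimes>\<^sub>M MX" and ?S = "Sigma (space (path_space MY)) X"
  have S: "?S \<subseteq> space ?M" using sets.sets_into_space[OF X] .
  have "(\<lambda>p. if p \<in> ?S then (\<lambda>(\<omega>, x). R \<omega> x) p else m (fst p)) \<in> ?M \<rightarrow>\<^sub>M prob_algebra MX"
  proof (subst measurable_If_restrict_space_iff)
    have "{p \<in> space ?M. p \<in> ?S} = ?S" using S by auto
    then show "{p \<in> space ?M. p \<in> ?S} \<in> sets ?M" using X by simp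
    show "(\<lambda>(\<omega>, x). R \<omega> x) \<in> restrict_space ?M {p. p \<in> ?S} \<rightarrow>\<^sub>M prob_algebra MX \<and>
        (\<lambda>p. m (fst p)) \<in> restrict_space ?M {p. p \<notin> ?S} \<rightarrow>\<^sub>M prob_algebra MX"
      using R measurable_restrict_space1[OF measurable_compose[OF measurable_fst m]] by auto
  qed
  then show ?thesis
    by (rule measurable_cong[THEN iffD1, rotated]) (auto simp: space_pair_measure split: if_splits)
qed

lemma AE_all_lshift:
  assumes P: "sets P = sets (path_space MY)"
    and inv: "\<And>k. distr P (path_space MY) (lshift k) = P" and ae: "AE \<omega> in P. H \<omega>"
  shows "AE \<omega> in P. \<forall>k. H (lshift k \<omega>)"
proof (subst AE_all_countable, rule allI)
  fix k
  show "AE \<omega> in P. H (lshift k \<omega>)"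
    by (rule AE_distrD[OF lshift_measurable_law[OF P]]) (use ae in \<open>subst inv\<close>)
qed

text \<open>H is an arbitrary predicate, so its failure set is first covered by a measurable null
  set Z. Removing every integer shift of Z leaves an exactly shift-invariant set, still of full
  measure because the shifts are countable and preserve P.\<close>

lemma invariant_good_set:
  assumes P: "sets P = sets (path_space MY)"
    and inv: "\<And>k. distr P (path_space MY) (lshift k) = P" and ae: "AE \<omega> in P. H \<omega>"
  shows "\<exists>G\<in>sets (path_space MY). (AE \<omega> in P. \<omega> \<in> G) \<and> (\<forall>\<omega>\<in>G. H \<omega> \<and> (\<forall>k. lshift k \<omega> \<in> G))"
proof -
  have sp: "space P = space (path_space MY)" using P by (rule sets_eq_imp_space_eq)
  obtain Z where Z: "{\<omega> \<in> space P. \<not> H \<omega>} \<subseteq> Z" "emeasure P Z = 0" "Z \<in> sets P" using AE_E[OF ae] by blast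
  define G where "G = (\<Inter>k. lshift k -` (space (path_space MY) - Z) \<inter> space (path_space MY))"
  have "G \<in> sets (path_space MY)"
    unfolding G_def using Z P by (intro sets.countable_INT' measurable_sets[OF lshift_measurable]) auto
  moreover have "AE \<omega> in P. \<omega> \<in> G"
  proof -
    have "AE \<omega> in P. \<omega> \<notin> Z" using Z by (intro AE_not_in) (auto simp: null_sets_def)
    from AE_all_lshift[OF P inv this] show ?thesis
      using AE_space by eventually_elim (use lshift_space sp in \<open>auto simp: G_def\<close>)
  qed
  moreover have "H \<omega>" if "\<omega> \<in> G" for \<omega>
  proof -
    have "lshift 0 \<omega> \<in> space (path_space MY) - Z" using that unfolding G_def by blast
    then show ?thesis using Z(1) sp by auto
  qed
  moreover have "lshift k \<omega> \<in> G" if "\<omega> \<in> G" for \<omega> k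
    using that lshift_space by (auto simp: G_def)
  ultimately show ?thesis by blast
qed

lemma powr_rate_bound:
  fixes v \<rho> S p :: real
  assumes v: "0 \<le> v" "v \<le> 1" "v \<le> \<rho> ^ n * S" and \<rho>: "0 < \<rho>" and S: "0 \<le> S" and p: "1 \<le> p"
  shows "v \<le> S powr (1 / p) * \<rho> powr (real n / p)"
proof -
  have "v \<le> v powr (1 / p)"
  proof (cases "v = 0")
    case False
    then have "v powr 1 \<le> v powr (1 / p)" using v p by (intro powr_mono') auto
    then show ?thesis using False v by simp
  qed simp
  also have "\<dots> \<le> (\<rho> ^ n * S) powr (1 / p)" using v p by (intro powr_mono2) auto
  also have "\<dots> = S powr (1 / p) * \<rho> powr (real n / p)"
    using \<rho> S by (simp add: powr_mult powr_powr powr_realpow[symmetric])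
  finally show ?thesis .
qed

text \<open>No uniform bounds on n and \<gamma> are available, but \<open>n \<omega>\<close> is
  finite and \<open>\<gamma> \<omega>\<close> positive, so the events increase to the whole space.
  The offsets keep the threshold strictly below 1 and the length at least 1 even for k = 0.\<close>

lemma (in prob_space) exhausting_level:
  fixes n :: "'a \<Rightarrow> nat" and \<gamma> :: "'a \<Rightarrow> real"
  assumes n: "n \<in> M \<rightarrow>\<^sub>M count_space UNIV" and \<gamma>: "\<gamma> \<in> borel_measurable M" "\<And>\<omega>. \<omega> \<in> space M \<Longrightarrow> 0 < \<gamma> \<omega>"
    and c: "c < 1"
  shows "\<exists>k. c < prob {\<omega> \<in> space M. \<gamma> \<omega> \<ge> 1 / (real k + 2) \<and> n \<omega> \<le> k + 1}"
proof -
  define A where "A k = {\<omega> \<in> space M. \<gamma> \<omega> \<ge> 1 / (real k + 2) \<and> n \<omega> \<le> k + 1}" for k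
  have A: "A k \<in> events" for k unfolding A_def using n \<gamma>(1) by measurable
  have "incseq A"
  proof (rule incseq_SucI, rule subsetI)
    fix k \<omega> assume "\<omega> \<in> A k"
    moreover have "1 / (real (Suc k) + 2) \<le> 1 / (real k + 2)" by (simp add: frac_le)
    ultimately show "\<omega> \<in> A (Suc k)" unfolding A_def by auto
  qed
  moreover have "(\<Union>k. A k) = space M"
  proof
    show "space M \<subseteq> (\<Union>k. A k)"
    proof
      fix \<omega> assume w: "\<omega> \<in> space M"
      obtain j :: nat where j: "1 / \<gamma> \<omega> < real j" using reals_Archimedean2 by blast
      define k where "k = max j (n \<omega>)"
      have "1 / \<gamma> \<omega> \<le> real k + 2" using j by (auto simp: k_def max_def)
      then have "1 / (real k + 2) \<le> \<gamma> \<omega>" using \<gamma>(2)[OF w] by (simp add: field_simps)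
      then have "\<omega> \<in> A k" using w by (simp add: A_def k_def)
      then show "\<omega> \<in> (\<Union>k. A k)" by blast
    qed
  qed (auto simp: A_def)
  ultimately have "(\<lambda>k. prob (A k)) \<longlonglongrightarrow> 1"
    using finite_Lim_measure_incseq[of A] A prob_space by auto
  then have "\<forall>\<^sub>F k in sequentially. c < prob (A k)" using c by (rule order_tendstoD)
  then show ?thesis unfolding A_def by (auto simp: eventually_sequentially)
qed

lemma random_doeblinE:
  assumes "random_doeblin MY P MX X R"
  obtains n \<gamma> m where "n \<in> path_space MY \<rightarrow>\<^sub>M count_space (UNIV :: nat set)"
    "\<gamma> \<in> borel_measurable (path_space MY)" "\<And>\<omega>. \<omega> \<in> space (path_space MY) \<Longrightarrow> 0 < \<gamma> \<omega>"
    "random_prob_family MY MX X m"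
    "AE \<omega> in P. doeblin_bound MX X R \<omega> (n \<omega>) (\<gamma> \<omega>) (m \<omega>)"
    "\<And>M \<delta>. 1 \<le> M \<Longrightarrow> 0 < \<delta> \<Longrightarrow>
      {\<omega> \<in> space (path_space MY). \<gamma> \<omega> \<ge> \<delta> \<and> n \<omega> \<le> M} \<in> coord_sigma MY {- int M..0}"
  using assms unfolding random_doeblin_def
proof (elim exE conjE, goal_cases)
  case (1 n \<gamma> m)
  show ?thesis by (rule that[OF 1(2,4) _ 1(6,8)]) (use 1(5,12) in simp_all)
qed

section \<open>Choice of the parameters and the moment bounds\<close>

theorem theorem2p4:
  fixes N :: "'a measure" and MY :: "'y measure" and Y :: "int \<Rightarrow> 'a \<Rightarrow> 'y"
    and P :: "(int \<Rightarrow> 'y) measure"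
    and MX :: "'x measure" and X :: "(int \<Rightarrow> 'y) \<Rightarrow> 'x set"
    and R :: "(int \<Rightarrow> 'y) \<Rightarrow> 'x \<Rightarrow> 'x measure"
  assumes "prob_space N"
    and "stationary_process N MY Y"
    and "ergodic_process N MY Y"
    and P: "P = path_law N MY Y"
    and "random_subspaces MY MX X"
    and "random_kernel MY P MX X R"
    and "psi_U MY P \<longlonglongrightarrow> 0"
    and "random_doeblin MY P MX X R"
  shows "\<exists>\<mu>. random_prob_family MY MX X \<mu> \<and>
           (AE \<omega> in P. dual_markov X R \<omega> (\<mu> \<omega>) = \<mu> (lshift 1 \<omega>)) \<and>
           (\<forall>\<nu>. random_prob_family MY MX X \<nu> \<and>
                 (AE \<omega> in P. dual_markov X R \<omega> (\<nu> \<omega>) = \<nu> (lshift 1 \<omega>)) \<longrightarrow>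
                 (AE \<omega> in P. \<nu> \<omega> = \<mu> \<omega>)) \<and>
           (\<exists>\<rho>::real. 0 < \<rho> \<and> \<rho> < 1 \<and>
              (\<forall>p::real. 1 \<le> p \<longrightarrow>
                (\<exists>K::(int \<Rightarrow> 'y) \<Rightarrow> real. K \<in> borel_measurable P \<and>
                   integrable P (\<lambda>\<omega>. \<bar>K \<omega>\<bar> powr p) \<and>
                   (AE \<omega> in P. \<forall>n::nat. 1 \<le> n \<longrightarrow>
                      max (op_dist MX X R n (lshift (- int n) \<omega>) (\<mu> \<omega>))
                          (op_dist MX X R n \<omega> (\<mu> (lshift (int n) \<omega>)))
                        \<le> ereal (K \<omega> * \<rho> powr (real n / p))))))"
proof -
  obtain n \<gamma> m where nm: "n \<in> path_space MY \<rightarrow>\<^sub>M count_space (UNIV :: nat set)"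
    and \<gamma>: "\<gamma> \<in> borel_measurable (path_space MY)" "\<And>\<omega>. \<omega> \<in> space (path_space MY) \<Longrightarrow> 0 < \<gamma> \<omega>"
    and m: "random_prob_family MY MX X m"
    and doeb: "AE \<omega> in P. doeblin_bound MX X R \<omega> (n \<omega>) (\<gamma> \<omega>) (m \<omega>)"
    and loc: "\<And>M \<delta>. 1 \<le> M \<Longrightarrow> 0 < \<delta> \<Longrightarrow> {\<omega> \<in> space (path_space MY). \<gamma> \<omega> \<ge> \<delta> \<and> n \<omega> \<le> M} \<in> coord_sigma MY {- int M..0}"
    by (rule random_doeblinE[OF \<open>random_doeblin MY P MX X R\<close>]) (rule that)
  have Pset: "sets P = sets (path_space MY)" by (simp add: P path_law_def)
  have Psp: "space P = space (path_space MY)" using Pset by (rule sets_eq_imp_space_eq)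
  have Pprob: "prob_space P"
  proof -
    have Y: "\<And>j. Y j \<in> N \<rightarrow>\<^sub>M MY" using \<open>stationary_process N MY Y\<close> by (auto simp: stationary_process_def)
    have "(\<lambda>x j. Y j x) \<in> N \<rightarrow>\<^sub>M path_space MY"
      using Y measurable_space[OF Y] by (intro measurable_PiM_single') auto
    then show ?thesis unfolding P path_law_def by (rule prob_space.prob_space_distr[OF \<open>prob_space N\<close>])
  qed
  interpret P: prob_space P by (rule Pprob)
  have inv: "distr P (path_space MY) (lshift k) = P" for k
    unfolding P by (rule lshift_invariant_path_law[OF \<open>stationary_process N MY Y\<close>])
  have mm: "m \<in> path_space MY \<rightarrow>\<^sub>M prob_algebra MX" using m by (simp add: random_prob_family_def)
  have m': "m \<omega> \<in> space (prob_algebra MX)" "measure (m \<omega>) (X \<omega>) = 1" if "\<omega> \<in> space (path_space MY)" for \<omega>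
    using measurable_space[OF mm that] m that by (auto simp: random_prob_family_def)

  \<comment> \<open>\<open>R\<close> is measurable on the graph of \<open>X\<close> only; any jointly measurable total extension will do.\<close>
  define Q where "Q \<omega> x = (if x \<in> X \<omega> then R \<omega> x else m \<omega>)" for \<omega> x
  interpret markov_environment MY MX X Q
  proof
    show Xg: "Sigma (space (path_space MY)) X \<in> sets (path_space MY \<Otimes>\<^sub>M MX)"
      using \<open>random_subspaces MY MX X\<close> by (simp add: random_subspaces_def)
    show "(\<lambda>(\<omega>, x). Q \<omega> x) \<in> path_space MY \<Otimes>\<^sub>M MX \<rightarrow>\<^sub>M prob_algebra MX"
      unfolding Q_def using \<open>random_kernel MY P MX X R\<close>
      by (intro extended_kernel_measurable[OF Xg _ mm]) (simp add: random_kernel_def)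
  qed
  have R: "Q \<omega> x = R \<omega> x" if "\<omega> \<in> space (path_space MY)" "x \<in> X \<omega>" for \<omega> x using that by (simp add: Q_def)

  have "\<forall>\<^sub>F k in sequentially. psi_U MY P k < 1"
    using \<open>psi_U MY P \<longlonglongrightarrow> 0\<close> by (rule order_tendstoD) simp
  then obtain n0 where n0: "psi_U MY P n0 < 1" by (auto simp: eventually_sequentially)
  obtain k where k: "3 / 4 < P.prob {\<omega> \<in> space P. \<gamma> \<omega> \<ge> 1 / (real k + 2) \<and> n \<omega> \<le> k + 1}"
    using P.exhausting_level[of n \<gamma> "3/4"] nm \<gamma> Psp Pset by (auto cong: measurable_cong_sets)
  define d where "d = 1 / (real k + 2)"
  define L where "L = (k + 1) + n0"
  define A where "A = {\<omega> \<in> space (path_space MY). \<gamma> \<omega> \<ge> d \<and> n \<omega> \<le> k + 1}"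
  have d: "0 < d" "d < 1" by (auto simp: d_def)
  have A: "A \<in> coord_sigma MY {- int (k + 1)..0}" unfolding A_def by (rule loc) (use d in auto)
  have pA: "3 / 4 \<le> P.prob A" using k by (simp add: A_def d_def Psp)
  obtain \<rho> S where \<rho>: "0 < \<rho>" "\<rho> < (1::real)" and S: "integrable P S" "\<And>\<omega>. (0::real) \<le> S \<omega>"
    and rate: "AE \<omega> in P. \<forall>n. decay A L d n \<omega> \<le> \<rho> ^ n * S \<omega> \<and> decay A L d n (lshift (- int n) \<omega>) \<le> \<rho> ^ n * S \<omega>"
    using decay_rate[OF Pprob Pset inv n0 A L_def _ d pA] by (auto simp: L_def)

  have "AE \<omega> in P. \<forall>x\<in>X \<omega>. measure (R \<omega> x) (X (lshift 1 \<omega>)) = 1"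
    using \<open>random_kernel MY P MX X R\<close> by (simp add: random_kernel_def)
  \<comment> \<open>The three almost sure properties are joined first, so that a single invariant
    set G provides all of them at every shift of its points.\<close>
  then have "AE \<omega> in P. (\<forall>x\<in>X \<omega>. measure (R \<omega> x) (X (lshift 1 \<omega>)) = 1) \<and>
      doeblin_bound MX X R \<omega> (n \<omega>) (\<gamma> \<omega>) (m \<omega>) \<and>
      (\<forall>n. decay A L d n \<omega> \<le> \<rho> ^ n * S \<omega> \<and> decay A L d n (lshift (- int n) \<omega>) \<le> \<rho> ^ n * S \<omega>)"
    using doeb rate by eventually_elim auto
  from invariant_good_set[OF Pset inv this] obtain G where G: "G \<in> sets (path_space MY)" "AE \<omega> in P. \<omega> \<in> G"
    and shift: "\<And>\<omega> k. \<omega> \<in> G \<Longrightarrow> lshift k \<omega> \<in> G"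
    and R1: "\<And>\<omega> x. \<omega> \<in> G \<Longrightarrow> x \<in> X \<omega> \<Longrightarrow> measure (R \<omega> x) (X (lshift 1 \<omega>)) = 1"
    and doebG: "\<And>\<omega>. \<omega> \<in> G \<Longrightarrow> doeblin_bound MX X R \<omega> (n \<omega>) (\<gamma> \<omega>) (m \<omega>)"
    and rateG: "\<And>\<omega> n. \<omega> \<in> G \<Longrightarrow> decay A L d n \<omega> \<le> \<rho> ^ n * S \<omega>"
      "\<And>\<omega> n. \<omega> \<in> G \<Longrightarrow> decay A L d n (lshift (- int n) \<omega>) \<le> \<rho> ^ n * S \<omega>"
    by blast
  have Gs: "\<omega> \<in> space (path_space MY)" if "\<omega> \<in> G" for \<omega> using sets.sets_into_space[OF G(1)] that by blast
  have car: "carried X Q \<omega>" if "\<omega> \<in> G" for \<omega>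
    unfolding carried_def
  proof (intro allI ballI)
    fix k x assume "x \<in> X (lshift k \<omega>)"
    then show "measure (Q (lshift k \<omega>) x) (X (lshift (k + 1) \<omega>)) = 1"
      using R1[OF shift[OF that], of x k] R[OF Gs[OF shift[OF that]], of x k] by (simp add: add.commute)
  qed
  have min: "minorized MX X Q L d \<omega>" if "\<omega> \<in> G" "\<omega> \<in> A" for \<omega>
    using that(2) by (intro minorized_of_doeblin_bound[OF R Gs[OF that(1)] car[OF that(1)] doebG[OF that(1)] m'[OF Gs[OF that(1)]]])
      (auto simp: A_def L_def)
  note minG = min[OF shift]
  have d0: "0 \<le> d" using d by simp
  note db = decay_bounds[OF d0 less_imp_le[OF d(2)], of A L]
  have lim: "(\<lambda>n. decay A L d n (lshift (- int n) \<omega>)) \<longlonglongrightarrow> 0" if "\<omega> \<in> G" for \<omega>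
  proof (rule tendsto_sandwich[where f="\<lambda>_. 0" and h="\<lambda>n. \<rho> ^ n * S \<omega>"])
    have "(\<lambda>n. \<rho> ^ n) \<longlonglongrightarrow> 0" using \<rho> by (intro LIMSEQ_power_zero) auto
    then show "(\<lambda>n. \<rho> ^ n * S \<omega>) \<longlonglongrightarrow> 0" by (rule tendsto_mult_left_zero)
  qed (use db rateG(2)[OF that] in auto)

  obtain \<mu> where \<mu>: "random_prob_family MY MX X \<mu>" and \<mu>inv: "\<And>\<omega>. \<omega> \<in> G \<Longrightarrow> \<mu> \<omega> \<bind> Q \<omega> = \<mu> (lshift 1 \<omega>)"
    using invariant_family_exists[OF m d0 G(1) shift car min lim] by blast
  have fam: "\<nu> \<omega> \<in> space (prob_algebra MX)" "measure (\<nu> \<omega>) (X \<omega>) = 1"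
    if "random_prob_family MY MX X \<nu>" "\<omega> \<in> space (path_space MY)" for \<nu> \<omega>
    using that measurable_space[of \<nu> "path_space MY" "prob_algebra MX" \<omega>] by (auto simp: random_prob_family_def)
  have \<mu>inv': "\<mu> (lshift k \<omega>) \<bind> Q (lshift k \<omega>) = \<mu> (lshift (k + 1) \<omega>)" if "\<omega> \<in> G" for k \<omega>
    using \<mu>inv[OF shift[OF that], of k] by (simp add: add.commute)
  have dual: "dual_markov X R \<omega> (\<nu> \<omega>) = \<nu> \<omega> \<bind> Q \<omega>"
    if "random_prob_family MY MX X \<nu>" "\<omega> \<in> space (path_space MY)" for \<nu> \<omega>
    by (rule dual_markov_eq_bind[OF R that(2) fam[OF that]])

  have invariant: "AE \<omega> in P. dual_markov X R \<omega> (\<mu> \<omega>) = \<mu> (lshift 1 \<omega>)"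
    using G(2) by eventually_elim (simp add: dual[OF \<mu> Gs] \<mu>inv)
  have unique: "AE \<omega> in P. \<nu> \<omega> = \<mu> \<omega>"
    if \<nu>: "random_prob_family MY MX X \<nu>" and ae: "AE \<omega> in P. dual_markov X R \<omega> (\<nu> \<omega>) = \<nu> (lshift 1 \<omega>)" for \<nu>
    \<comment> \<open>The comparison with \<mu> goes back arbitrarily far, so the almost sure
      invariance of \<nu> is needed at all integer shifts simultaneously.\<close>
    using G(2) AE_all_lshift[OF Pset inv ae]
  proof eventually_elim
    case (elim \<omega>)
    note w = elim(1)
    have sp: "lshift k \<omega> \<in> space (path_space MY)" for k using Gs[OF shift[OF w]] .
    have \<nu>inv: "\<nu> (lshift k \<omega>) \<bind> Q (lshift k \<omega>) = \<nu> (lshift (k + 1) \<omega>)" for k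
      using elim(2)[rule_format, of k] dual[OF \<nu> sp, of k] by (simp add: add.commute)
    show ?case
      by (rule invariant_family_unique[where \<mu>=\<mu> and \<nu>=\<nu>,
            OF Gs[OF w] car[OF w] d0 minG[OF w] lim[OF w] fam[OF \<mu> sp] \<mu>inv'[OF w] fam[OF \<nu> sp] \<nu>inv])
  qed
  have bounds: "op_dist MX X R n (lshift (- int n) \<omega>) (\<mu> \<omega>) \<le> ereal (2 * decay A L d n (lshift (- int n) \<omega>))"
    "op_dist MX X R n \<omega> (\<mu> (lshift (int n) \<omega>)) \<le> ereal (2 * decay A L d n \<omega>)" if w: "\<omega> \<in> G" for n \<omega>
  proof -
    \<comment> \<open>The forward estimate is enough: the pullback bound is the same estimate
      started at \<open>lshift (- int n) \<omega>\<close>, which again lies in G.\<close>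
    have *: "op_dist MX X R n \<omega>' (\<mu> (lshift (int n) \<omega>')) \<le> ereal (2 * decay A L d n \<omega>')" if w': "\<omega>' \<in> G" for \<omega>'
    proof -
      have "\<mu> \<omega>' \<bind> kern n \<omega>' = \<mu> (lshift (int n) \<omega>')"
        using invariant_iterate[of \<omega>' \<mu> 0 n, OF Gs[OF w'] fam(1)[OF \<mu> Gs[OF shift[OF w']]] \<mu>inv'[OF w']] by simp
      then show ?thesis
        using op_dist_le_decay[OF R Gs[OF w'] car[OF w'] d0 minG[OF w'] fam[OF \<mu> Gs[OF w']], where n=n] by simp
    qed
    show "op_dist MX X R n (lshift (- int n) \<omega>) (\<mu> \<omega>) \<le> ereal (2 * decay A L d n (lshift (- int n) \<omega>))"
      using *[OF shift[OF w, of "- int n"]] by simp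
    show "op_dist MX X R n \<omega> (\<mu> (lshift (int n) \<omega>)) \<le> ereal (2 * decay A L d n \<omega>)" using *[OF w] .
  qed
  have moments: "\<exists>K. K \<in> borel_measurable P \<and> integrable P (\<lambda>\<omega>. \<bar>K \<omega>\<bar> powr p) \<and>
      (AE \<omega> in P. \<forall>n::nat. 1 \<le> n \<longrightarrow>
         max (op_dist MX X R n (lshift (- int n) \<omega>) (\<mu> \<omega>)) (op_dist MX X R n \<omega> (\<mu> (lshift (int n) \<omega>)))
           \<le> ereal (K \<omega> * \<rho> powr (real n / p)))" if p: "1 \<le> p" for p :: real
  \<comment> \<open>The exponent \<open>1 / p\<close> turns the p-th moment of K into a multiple of
    the first moment of S, so a single \<rho> serves every p; the factor 2 comes from
    \<open>bounds\<close>.\<close>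
  proof (intro exI[of _ "\<lambda>\<omega>. 2 * S \<omega> powr (1 / p)"] conjI)
    show "(\<lambda>\<omega>. 2 * S \<omega> powr (1 / p)) \<in> borel_measurable P" using S(1) by measurable
    have "\<bar>2 * S \<omega> powr (1 / p)\<bar> powr p = 2 powr p * S \<omega>" for \<omega>
      using S(2)[of \<omega>] p by (simp add: powr_mult powr_powr)
    then show "integrable P (\<lambda>\<omega>. \<bar>2 * S \<omega> powr (1 / p)\<bar> powr p)" using S(1) by simp
    show "AE \<omega> in P. \<forall>n::nat. 1 \<le> n \<longrightarrow>
         max (op_dist MX X R n (lshift (- int n) \<omega>) (\<mu> \<omega>)) (op_dist MX X R n \<omega> (\<mu> (lshift (int n) \<omega>)))
           \<le> ereal (2 * S \<omega> powr (1 / p) * \<rho> powr (real n / p))"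
      using G(2)
    proof eventually_elim
      case (elim \<omega>)
      have le: "ereal (2 * v) \<le> ereal (2 * S \<omega> powr (1 / p) * \<rho> powr (real n / p))"
        if "0 \<le> v" "v \<le> 1" "v \<le> \<rho> ^ n * S \<omega>" for v n
        using powr_rate_bound[OF that \<rho>(1) S(2) p] by simp
      show ?case
        using order_trans[OF bounds(1)[OF elim] le[OF db rateG(2)[OF elim]]]
          order_trans[OF bounds(2)[OF elim] le[OF db rateG(1)[OF elim]]] by simp
    qed
  qed
  show ?thesis
    using \<mu> invariant unique \<rho> moments by (intro exI[of _ \<mu>] conjI exI[of _ \<rho>]) auto
qed

end
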